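(* Let $k$ be a positive integer and let $G$ be a $k$-multiple tree. Then there is a spanning tree factorization $(T_1,\ldots,T_k)$ of $G$ such that $|d_{T_i}(v)-d_{T_j}(v)|\leq 22\log(k)$ for all $v \in V(G)$ and $i,j \in \{1,\ldots,k\}$.
   Context: Graphs are finite and may have parallel edges. For a positive integer $k$, a graph $G$ is a $k$-multiple tree if there are spanning trees $T_1,\ldots,T_k$ of $G$ that are pairwise edge-disjoint and satisfy $E(T_1)\cup\cdots\cup E(T_k)=E(G)$; the tuple $(T_1,\ldots,T_k)$ is then called a spanning tree factorization of $G$. $d_T(v)$ denotes the number of edges of $T$ incident to $v$. $\log$ denotes the logarithm to base $2$. *)

theory Defs
  imports Complex_Main
begin

text \<open>
  Finite undirected loopless multigraphs: edges are abstract objects and \<open>ends e\<close> is the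
  set of the two endvertices of \<open>e\<close>, so that distinct edges may be parallel.
  The predicates \<open>tree\<close> and \<open>spanning_tree\<close> of the AFP entry on directed graphs do not fit:
  \<open>forest\<close> excludes only directed cycles there, so an oriented multigraph with
  an undirected cycle may count as a tree, and a symmetric digraph with an edge never does.
\<close>

record ('v, 'e) multigraph =
  verts :: "'v set"
  edges :: "'e set"
  ends :: "'e \<Rightarrow> 'v set"

definition multigraph :: "('v, 'e) multigraph \<Rightarrow> bool" where
  "multigraph G \<longleftrightarrow> finite (verts G) \<and> finite (edges G) \<and>
     (\<forall>e \<in> edges G. ends G e \<subseteq> verts G \<and> card (ends G e) = 2)"

definition degree :: "('v, 'e) multigraph \<Rightarrow> 'v \<Rightarrow> nat" where
  "degree G v = card {e \<in> edges G. v \<in> ends G e}"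

definition subgraph :: "('v, 'e) multigraph \<Rightarrow> ('v, 'e) multigraph \<Rightarrow> bool" where
  "subgraph H G \<longleftrightarrow> multigraph H \<and> verts H \<subseteq> verts G \<and> edges H \<subseteq> edges G \<and>
     (\<forall>e \<in> edges H. ends H e = ends G e)"

definition walk :: "('v, 'e) multigraph \<Rightarrow> 'v list \<Rightarrow> 'e list \<Rightarrow> bool" where
  "walk G vs es \<longleftrightarrow> length vs = Suc (length es) \<and> set vs \<subseteq> verts G \<and> set es \<subseteq> edges G \<and>
     (\<forall>i < length es. ends G (es ! i) = {vs ! i, vs ! Suc i})"

definition connected_graph :: "('v, 'e) multigraph \<Rightarrow> bool" where
  "connected_graph G \<longleftrightarrow> verts G \<noteq> {} \<and>
     (\<forall>u \<in> verts G. \<forall>v \<in> verts G. \<exists>vs es. walk G vs es \<and> hd vs = u \<and> last vs = v)"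

text \<open>Two parallel edges form a cycle of length 2.\<close>

definition cycle :: "('v, 'e) multigraph \<Rightarrow> 'v list \<Rightarrow> 'e list \<Rightarrow> bool" where
  "cycle G vs es \<longleftrightarrow> length vs = length es \<and> 2 \<le> length es \<and>
     set vs \<subseteq> verts G \<and> set es \<subseteq> edges G \<and> distinct vs \<and> distinct es \<and>
     (\<forall>i < length es. ends G (es ! i) = {vs ! i, vs ! (Suc i mod length vs)})"

definition tree :: "('v, 'e) multigraph \<Rightarrow> bool" where
  "tree G \<longleftrightarrow> multigraph G \<and> connected_graph G \<and> (\<nexists>vs es. cycle G vs es)"

definition spanning_tree :: "('v, 'e) multigraph \<Rightarrow> ('v, 'e) multigraph \<Rightarrow> bool" where
  "spanning_tree T G \<longleftrightarrow> subgraph T G \<and> verts T = verts G \<and> tree T"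

text \<open>The tuple \<open>(T\<^sub>1, \<dots>, T\<^sub>k)\<close> is a function of which only the values on \<open>{1..k}\<close> matter.\<close>

definition spanning_tree_factorization ::
    "nat \<Rightarrow> ('v, 'e) multigraph \<Rightarrow> (nat \<Rightarrow> ('v, 'e) multigraph) \<Rightarrow> bool" where
  "spanning_tree_factorization k G T \<longleftrightarrow>
     (\<forall>i \<in> {1..k}. spanning_tree (T i) G) \<and>
     (\<forall>i \<in> {1..k}. \<forall>j \<in> {1..k}. i \<noteq> j \<longrightarrow> edges (T i) \<inter> edges (T j) = {}) \<and>
     (\<Union>i \<in> {1..k}. edges (T i)) = edges G"

definition multiple_tree :: "nat \<Rightarrow> ('v, 'e) multigraph \<Rightarrow> bool" where
  "multiple_tree k G \<longleftrightarrow> multigraph G \<and> (\<exists>T. spanning_tree_factorization k G T)"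

end

theory Submission
  imports Defs
begin

text \<open>
  Two disjoint spanning trees on the same vertices can be replaced by two trees with the same union
  whose degrees differ by at most 6 everywhere. The union \<open>P\<close> of the two trees is characterised by
  \<open>|Q| \<le> 2 |V(Q)| - 2\<close> for nonempty \<open>Q \<subseteq> P\<close>, with equality for \<open>P\<close>. If some proper \<open>Q\<close> is tight,
  \<open>P\<close> decomposes into \<open>Q\<close> and \<open>P / V(Q)\<close>, whose factorizations combine freely. If none is, a vertex
  \<open>w\<close> of degree 3 with neighbours \<open>x, y, z\<close> may be replaced by an edge \<open>xz\<close>: then \<open>wx\<close> and \<open>wz\<close> inherit
  the tree of \<open>xz\<close>, \<open>wy\<close> goes to the other one, and only the degrees of \<open>w\<close> and \<open>y\<close> are affected. A piece
  with two parallel edges gives a choice of sign, and these signs are settled at the end by a balanced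
  orientation. Each vertex whose degrees still have to be controlled is a class of half-edges; when no
  step is possible without disturbing a class, counting shows that some class has at most 5
  half-edges left, and it may be given up.

  For \<open>k\<close> trees, balancing pairs in the pattern of a butterfly network brings \<open>2^m\<close> trees within \<open>3 m\<close> of
  their average degrees, where \<open>2^m \<le> k < 2^(m + 1)\<close>. Balancing the remaining trees against different
  members of this group halves the largest difference up to an error \<open>6 m + 3\<close>, so a factorization with the
  least possible largest difference achieves \<open>12 m + 6 \<le> 22 log k\<close>.
\<close>

section \<open>Sparse edge sets\<close>

text \<open>
  An edge \<open>e\<close> consists of the half-edges \<open>(e, True)\<close> and \<open>(e, False)\<close>, and \<open>h\<close> maps a half-edge to its
  vertex. The vertices of an edge set are those it covers, so isolated vertices do not occur.
\<close>

definition vset :: "('e \<times> bool \<Rightarrow> 'v) \<Rightarrow> 'e set \<Rightarrow> 'v set" where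
  "vset h Q = h ` (Q \<times> UNIV)"

text \<open>\<open>sparse 1\<close> means acyclic.\<close>

definition sparse :: "nat \<Rightarrow> ('e \<times> bool \<Rightarrow> 'v) \<Rightarrow> 'e set \<Rightarrow> bool" where
  "sparse k h P \<longleftrightarrow> (\<forall>Q \<subseteq> P. Q \<noteq> {} \<longrightarrow> card Q + k \<le> k * card (vset h Q))"

text \<open>By the theorem of Nash-Williams, these are the edge sets that decompose into two
  spanning trees of the vertices they cover. Only the count enters the definition; the decomposition
  itself is produced by \<open>balanceable_pieces\<close>.\<close>

definition double_tree :: "('e \<times> bool \<Rightarrow> 'v) \<Rightarrow> 'e set \<Rightarrow> bool" where
  "double_tree h P \<longleftrightarrow> finite P \<and> P \<noteq> {} \<and> sparse 2 h P \<and> card P + 2 = 2 * card (vset h P)"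

lemma vset_Un: "vset h (P \<union> Q) = vset h P \<union> vset h Q"
  by (auto simp: vset_def)

lemma vset_mono: "P \<subseteq> Q \<Longrightarrow> vset h P \<subseteq> vset h Q"
  by (auto simp: vset_def)

lemma vset_insert: "vset h (insert e Q) = {h (e, i), h (e, \<not> i)} \<union> vset h Q"
  unfolding vset_def by (cases i) (auto simp: image_iff, (metis (full_types))+)

lemma vset_empty [simp]: "vset h {} = {}"
  by (simp add: vset_def)

lemma vset_eq_empty_iff [simp]: "vset h Q = {} \<longleftrightarrow> Q = {}"
  by (auto simp: vset_def)

lemma finite_vset [simp]: "finite Q \<Longrightarrow> finite (vset h Q)"
  by (simp add: vset_def)

lemma in_vsetI: "e \<in> Q \<Longrightarrow> h (e, i) \<in> vset h Q"
  by (auto simp: vset_def)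

lemma vset_cong: "(\<And>e i. e \<in> Q \<Longrightarrow> h (e, i) = h' (e, i)) \<Longrightarrow> vset h Q = vset h' Q"
  unfolding vset_def by (intro image_cong) auto

lemma sparse_cong:
  assumes "\<And>e i. e \<in> P \<Longrightarrow> h (e, i) = h' (e, i)"
  shows "sparse k h P \<longleftrightarrow> sparse k h' P"
proof -
  have "vset h Q = vset h' Q" if "Q \<subseteq> P" for Q
    using assms that by (intro vset_cong) auto
  then show ?thesis by (auto simp: sparse_def)
qed

lemma double_tree_cong:
  assumes "\<And>e i. e \<in> P \<Longrightarrow> h (e, i) = h' (e, i)"
  shows "double_tree h P \<longleftrightarrow> double_tree h' P"
  using sparse_cong[of P h h' 2] vset_cong[of P h h'] assms by (auto simp: double_tree_def)

lemma sparse_subset: "sparse k h P \<Longrightarrow> Q \<subseteq> P \<Longrightarrow> sparse k h Q"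
  by (auto simp: sparse_def)

lemma sparseD: "sparse k h P \<Longrightarrow> Q \<subseteq> P \<Longrightarrow> Q \<noteq> {} \<Longrightarrow> card Q + k \<le> k * card (vset h Q)"
  by (auto simp: sparse_def)

lemma sparse_loopless:
  assumes "sparse k h P" "e \<in> P"
  shows "h (e, i) \<noteq> h (e, \<not> i)"
proof
  assume "h (e, i) = h (e, \<not> i)"
  then have "card (vset h {e}) = 1" by (simp add: vset_insert[of h e "{}" i])
  moreover have "card {e} + k \<le> k * card (vset h {e})"
    using assms by (intro sparseD[OF assms(1)]) auto
  ultimately show False by simp
qed

section \<open>Contraction of tight subsets\<close>

text \<open>Contraction redirects half-edges and leaves the edges alone. The merged vertex is
  represented by some \<open>x\<close> in \<open>X\<close>, so the vertex type stays the
  same.\<close>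

definition contract :: "'v set \<Rightarrow> 'v \<Rightarrow> ('e \<times> bool \<Rightarrow> 'v) \<Rightarrow> ('e \<times> bool \<Rightarrow> 'v)" where
  "contract X x h = (\<lambda>q. if h q \<in> X then x else h q)"

lemma vset_contract:
  "vset (contract X x h) R = (vset h R - X) \<union> (if vset h R \<inter> X = {} then {} else {x})"
  by (auto simp: vset_def contract_def image_iff)

lemma card_vset_contract:
  assumes "finite R" "x \<in> X"
  shows "card (vset (contract X x h) R) = card (vset h R - X) + (if vset h R \<inter> X = {} then 0 else 1)"
  using assms by (auto simp: vset_contract card_insert_if)

text \<open>For \<open>R \<subseteq> F\<close>, the part \<open>R \<inter> Q\<close> is counted
  under \<open>h\<close> and \<open>R - Q\<close> in the contraction. The former covers only
  vertices of \<open>X\<close>; the latter is charged to vertices outside \<open>X\<close> and at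
  most the merged vertex.\<close>

lemma sparse_expand:
  assumes "finite F" "sparse 1 h {e \<in> F. e \<in> Q}" "sparse 1 (contract X x h) (F - Q)"
    and X: "vset h Q \<subseteq> X" "x \<in> X"
  shows "sparse 1 h F"
  unfolding sparse_def
proof (intro allI impI)
  fix R assume R: "R \<subseteq> F" "R \<noteq> {}"
  have fR: "finite R" using R assms(1) finite_subset by blast
  let ?R1 = "R \<inter> Q" and ?R2 = "R - Q"
  have c: "card R = card ?R1 + card ?R2"
    using fR by (metis Diff_disjoint Int_Diff_Un card_Un_disjoint finite_Diff finite_Int Int_Diff Diff_Int_distrib inf_commute)
  have 1: "?R1 \<noteq> {} \<Longrightarrow> card ?R1 + 1 \<le> card (vset h ?R1)"
    using sparseD[OF assms(2), of ?R1] R by auto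
  have 2: "?R2 \<noteq> {} \<Longrightarrow> card ?R2 + 1 \<le> card (vset h ?R2 - X) + (if vset h ?R2 \<inter> X = {} then 0 else 1)"
  proof -
    assume "?R2 \<noteq> {}"
    then have "card ?R2 + 1 \<le> 1 * card (vset (contract X x h) ?R2)"
      using R by (intro sparseD[OF assms(3)]) auto
    then show ?thesis using card_vset_contract[of ?R2 x X h] fR X by simp
  qed
  have v: "vset h R = vset h ?R1 \<union> vset h ?R2" 
    by (metis vset_Un Int_Diff_Un)
  have v1: "vset h ?R1 \<subseteq> X" using X vset_mono[of ?R1 Q h] by blast
  have f: "finite (vset h ?R1)" "finite (vset h ?R2)" using fR by auto
  show "card R + 1 \<le> 1 * card (vset h R)"
  proof (cases "?R2 = {}")
    case True
    then have "R \<inter> Q = R" by auto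
    then show ?thesis using 1 R(2) by simp
  next
    case F2: False
    show ?thesis
    proof (cases "?R1 = {}")
      case True
      have "card (vset h ?R2 - X) + (if vset h ?R2 \<inter> X = {} then 0 else 1) \<le> card (vset h ?R2)"
      proof -
        have "card (vset h ?R2) = card (vset h ?R2 - X) + card (vset h ?R2 \<inter> X)"
          using f(2) by (metis card_Diff_subset_Int card_mono finite_Int inf_le1 le_add_diff_inverse2)
        moreover have "vset h ?R2 \<inter> X \<noteq> {} \<Longrightarrow> card (vset h ?R2 \<inter> X) \<ge> 1"
          using f(2) by (simp add: Suc_le_eq card_gt_0_iff)
        ultimately show ?thesis by auto
      qed
      then have "card ?R2 + 1 \<le> card (vset h ?R2)" using 2[OF F2] by linarith
      moreover have "?R2 = R" using True by auto
      ultimately show ?thesis by simp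
    next
      case False
      have "card (vset h ?R1) + card (vset h ?R2 - X) \<le> card (vset h R)"
        using v v1 f by (subst card_Un_disjoint[symmetric]) (auto intro!: card_mono)
      \<comment> \<open>When \<open>R\<close> meets both parts, the merged vertex is given up here;
        the additional vertex that is needed comes from \<open>?R1\<close>.\<close>
      moreover have "card ?R2 \<le> card (vset h ?R2 - X)" using 2[OF F2] by (simp split: if_splits)
      ultimately show ?thesis using 1[OF False] c by linarith
    qed
  qed
qed

text \<open>Subtracting the equality for \<open>Q\<close> from the sparsity of
  \<open>R \<union> Q\<close> bounds the size of \<open>R \<subseteq> P - Q\<close> by its vertices
  outside \<open>Q\<close>.\<close>

lemma double_tree_contract:
  assumes P: "double_tree h P" and Q: "Q \<subseteq> P" "Q \<noteq> P" "Q \<noteq> {}"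
    and t: "card Q + 2 = 2 * card (vset h Q)" and x: "x \<in> vset h Q"
  shows "double_tree h Q" "double_tree (contract (vset h Q) x h) (P - Q)"
proof -
  let ?X = "vset h Q"
  have fP: "finite P" and sp: "sparse 2 h P" and cP: "card P + 2 = 2 * card (vset h P)"
    using P by (auto simp: double_tree_def)
  have fQ: "finite Q" using fP Q finite_subset by auto
  show "double_tree h Q"
    using fQ Q t sparse_subset[OF sp] by (auto simp: double_tree_def)
  \<comment> \<open>If \<open>R\<close> misses \<open>?X\<close>, its own sparsity leaves a surplus
    of 2; otherwise the merged vertex supplies these 2 after contraction.\<close>
  have key: "card R + (if vset h R \<inter> ?X = {} then 2 else 0) \<le> 2 * card (vset h R - ?X)"
    if R: "R \<subseteq> P - Q" "R \<noteq> {}" for R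
  proof (cases "vset h R \<inter> ?X = {}")
    case True
    then have "vset h R - ?X = vset h R" by auto
    then show ?thesis using sparseD[OF sp, of R] R True by auto
  next
    case False
    have fR: "finite R" using R fP finite_subset by blast
    have "card (R \<union> Q) + 2 \<le> 2 * card (vset h (R \<union> Q))"
      using sparseD[OF sp, of "R \<union> Q"] R Q by auto
    moreover have "card (R \<union> Q) = card R + card Q"
      using fR fQ R by (intro card_Un_disjoint) auto
    moreover have "card (vset h (R \<union> Q)) = card (vset h R - ?X) + card ?X"
      using fR fQ by (subst card_Un_disjoint[symmetric]) (auto simp: vset_Un)
    ultimately show ?thesis using t False by auto
  qed
  have fin: "R \<subseteq> P - Q \<Longrightarrow> finite R" for R using fP finite_subset by blast
  have sp': "sparse 2 (contract ?X x h) (P - Q)"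
    unfolding sparse_def
  proof (intro allI impI)
    fix R assume R: "R \<subseteq> P - Q" "R \<noteq> {}"
    show "card R + 2 \<le> 2 * card (vset (contract ?X x h) R)"
      using key[OF R] fin[OF R(1)] x by (auto simp: card_vset_contract split: if_splits)
  qed
  have ne: "P - Q \<noteq> {}" using Q by auto
  have "card (P - Q) = card P - card Q" using Q fQ by (simp add: card_Diff_subset)
  moreover have "card (vset h (P - Q) - ?X) + card ?X = card (vset h P)"
  proof -
    have "vset h P = (vset h (P - Q) - ?X) \<union> ?X"
      using Q vset_Un[of h "P - Q" Q] by (auto simp: Un_absorb2)
    then show ?thesis using fP fQ by (metis Diff_disjoint card_Un_disjoint finite_Diff finite_vset inf_commute)
  qed
  moreover have "card Q \<le> card P" using Q fP by (simp add: card_mono)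
  ultimately have cR: "card (P - Q) = 2 * card (vset h (P - Q) - ?X)" using cP t by linarith
  \<comment> \<open>\<open>P - Q\<close> attains the bound without surplus, so it must touch
    \<open>?X\<close> and the merged vertex really occurs.\<close>
  then have nd: "vset h (P - Q) \<inter> ?X \<noteq> {}" using key[of "P - Q"] ne by auto
  have "card (P - Q) + 2 = 2 * card (vset (contract ?X x h) (P - Q))"
    using nd cR fP x by (simp add: card_vset_contract)
  then show "double_tree (contract ?X x h) (P - Q)"
    using ne sp' fP by (auto simp: double_tree_def)
qed

section \<open>Forests extended by a leaf or a subdivision\<close>

lemma forest_insert_leaf:
  assumes "finite F" "sparse 1 h F" "e \<notin> F" "h (e, i) \<notin> vset h F" "h (e, i) \<noteq> h (e, \<not> i)"
  shows "sparse 1 h (insert e F)"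
  unfolding sparse_def
proof (intro allI impI)
  fix Q assume Q: "Q \<subseteq> insert e F" "Q \<noteq> {}"
  have fQ: "finite Q" using Q assms(1) finite_subset by blast
  show "card Q + 1 \<le> 1 * card (vset h Q)"
  proof (cases "e \<in> Q")
    case False then show ?thesis using sparseD[OF assms(2), of Q] Q by auto
  next
    case True
    let ?R = "Q - {e}"
    have R: "?R \<subseteq> F" using Q by auto
    have QR: "Q = insert e ?R" using True by auto
    have cQ: "card Q = card ?R + 1" using fQ True by (metis QR card_insert_disjoint finite_Diff DiffE Suc_eq_plus1 insertI1)
    have v: "vset h Q = {h (e, i), h (e, \<not> i)} \<union> vset h ?R" by (metis QR vset_insert)
    show ?thesis
    proof (cases "?R = {}")
      case True
      then have "card ?R = 0" "vset h Q = {h (e, i), h (e, \<not> i)}" using v unfolding True by simp_all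
      then show ?thesis using cQ assms(5) by simp
    next
      case False
      have "h (e, i) \<notin> vset h ?R" using vset_mono[OF R, of h] assms(4) by auto
      then have "card (vset h ?R) + 1 = card (insert (h (e,i)) (vset h ?R))" using fQ by simp
      also have "\<dots> \<le> card (vset h Q)" using fQ v by (intro card_mono) auto
      finally show ?thesis using sparseD[OF assms(2) R False] cQ by auto
    qed
  qed
qed

text \<open>Under the modified map, \<open>e\<close> joins the two neighbours of \<open>w\<close>;
  under \<open>h\<close> this edge is subdivided at \<open>w\<close> into \<open>e\<close> and
  \<open>e'\<close>. A set with both \<open>e\<close> and \<open>e'\<close> has one edge and one
  vertex more than its counterpart without \<open>e'\<close>; in any other set \<open>w\<close> is
  at most a leaf.\<close>

lemma forest_subdivide:
  assumes "finite F" and F: "sparse 1 (h((e, i) := h (e', \<not> i'))) F" and e: "e \<in> F" "e' \<notin> F"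
    and w: "h (e, i) = w" "h (e', i') = w" "w \<notin> vset h (F - {e})"
      "h (e, \<not> i) \<noteq> w" "h (e', \<not> i') \<noteq> w"
  shows "sparse 1 h (insert e' F)"
  unfolding sparse_def
proof (intro allI impI)
  let ?h = "h((e, i) := h (e', \<not> i'))"
  fix Q assume Q: "Q \<subseteq> insert e' F" "Q \<noteq> {}"
  have fQ: "finite Q" using Q assms(1) finite_subset by blast
  have F0: "sparse 1 h (F - {e})"
    using sparse_cong[of "F - {e}" ?h h 1] sparse_subset[OF F, of "F - {e}"] by auto
  have Fe: "sparse 1 h F" 
    using forest_insert_leaf[OF _ F0, of e i] w assms(1) e by (auto simp: insert_absorb)
  have Fe': "sparse 1 h (insert e' (F - {e}))"
    using forest_insert_leaf[OF _ F0, of e' i'] w assms(1) e by auto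
  show "card Q + 1 \<le> 1 * card (vset h Q)"
  proof (cases "e \<in> Q \<and> e' \<in> Q")
    case False
    then have "Q \<subseteq> F \<or> Q \<subseteq> insert e' (F - {e})" using Q by auto
    then show ?thesis using sparseD[OF Fe, of Q] sparseD[OF Fe', of Q] Q by auto
  next
    case True
    let ?R = "Q - {e, e'}"
    have ee: "e \<noteq> e'" using e by auto
    have R: "?R \<subseteq> F - {e}" using Q by auto
    have c1: "card Q = card (insert e ?R) + 1" 
    proof -
      have "Q = insert e' (insert e ?R)" using True by auto
      then show ?thesis using fQ ee by (metis DiffE Suc_eq_plus1 card_insert_disjoint finite_Diff finite_insert insertCI insertE)
    qed
    have v: "vset h Q = {w, h (e, \<not> i), h (e', \<not> i')} \<union> vset h ?R"
    proof -
      have "Q = insert e' (insert e ?R)" using True by auto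
      then show ?thesis using vset_insert[of h e' "insert e ?R" i'] vset_insert[of h e ?R i] w by auto
    qed
    have v': "vset ?h (insert e ?R) = {h (e, \<not> i), h (e', \<not> i')} \<union> vset h ?R"
      using vset_insert[of ?h e ?R i] vset_cong[of ?R h ?h] by auto
    have "w \<notin> vset ?h (insert e ?R)" using v' w vset_mono[OF R, of h] by auto
    then have "card (vset ?h (insert e ?R)) + 1 = card (insert w (vset ?h (insert e ?R)))" using fQ by simp
    also have "\<dots> = card (vset h Q)" using v v' by (simp add: insert_commute)
    finally have "card (vset ?h (insert e ?R)) + 1 = card (vset h Q)" .
    moreover have "card (insert e ?R) + 1 \<le> 1 * card (vset ?h (insert e ?R))"
      using sparseD[OF F, of "insert e ?R"] R e by auto
    ultimately show ?thesis using c1 by auto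
  qed
qed

definition sg :: "bool \<Rightarrow> int" where
  "sg b = (if b then 1 else -1)"

lemma sg_not [simp]: "sg (\<not> b) = - sg b"
  by (simp add: sg_def)

lemma abs_sg [simp]: "\<bar>sg b\<bar> = 1"
  by (simp add: sg_def)

section \<open>Balanced orientations\<close>

text \<open>Each \<open>z\<close> is an arc between \<open>u z\<close> and \<open>t z\<close>, with
  head \<open>t z\<close> if \<open>col z\<close> holds and head \<open>u z\<close> otherwise. The
  sum is the indegree minus the outdegree at \<open>d\<close>, and a loop contributes 0.\<close>

definition arc_sum :: "('e \<Rightarrow> 'd) \<Rightarrow> ('e \<Rightarrow> 'd) \<Rightarrow> ('e \<Rightarrow> bool) \<Rightarrow> 'e set \<Rightarrow> 'd \<Rightarrow> int" where
  "arc_sum t u col Z d = (\<Sum>z \<in> Z. sg (col z) * (of_bool (t z = d) - of_bool (u z = d)))"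

lemma arc_sum_cong:
  assumes "\<And>z. z \<in> Z \<Longrightarrow> t z = t' z \<and> u z = u' z \<and> col z = col' z"
  shows "arc_sum t u col Z d = arc_sum t' u' col' Z d"
  unfolding arc_sum_def using assms by (intro sum.cong) auto

lemma arc_sum_insert:
  "finite Z \<Longrightarrow> z \<notin> Z \<Longrightarrow>
    arc_sum t u col (insert z Z) d = sg (col z) * (of_bool (t z = d) - of_bool (u z = d)) + arc_sum t u col Z d"
  unfolding arc_sum_def by simp

text \<open>Two arcs that share an end are merged into one, so that they cancel there.\<close>

lemma merge_arcs:
  fixes t u :: "'e \<Rightarrow> 'd"
  assumes Z: "finite Z" "y \<in> Z" "z \<in> Z" "y \<noteq> z"
    and IH: "\<And>t' u' :: 'e \<Rightarrow> 'd. \<exists>col. \<forall>d. \<bar>arc_sum t' u' col (Z - {z}) d\<bar> \<le> 1"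
    and eq: "\<And>d. of_bool (a = d) - of_bool (b = d) =
      ((of_bool (t y = d) - of_bool (u y = d)) + sg s * (of_bool (t z = d) - of_bool (u z = d)) :: int)"
  shows "\<exists>col. \<forall>d. \<bar>arc_sum t u col Z d\<bar> \<le> 1"
proof -
  obtain col where col: "\<And>d. \<bar>arc_sum (t(y := a)) (u(y := b)) col (Z - {z}) d\<bar> \<le> 1"
    using IH[of "t(y := a)" "u(y := b)"] by blast
  \<comment> \<open>The name \<open>y\<close> now stands for the merged arc; \<open>z\<close> copies
    its sign if \<open>s\<close> holds and takes the opposite sign otherwise.\<close>
  define col' where "col' = col(z := (col y = s))"
  have Y: "Z = insert z (insert y (Z - {y, z}))" "Z - {z} = insert y (Z - {y, z})" using Z by auto
  have sgz: "sg (col' z) = sg (col y) * sg s" by (auto simp: col'_def sg_def)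
  have "arc_sum t u col' Z d = arc_sum (t(y := a)) (u(y := b)) col (Z - {z}) d" for d
  proof -
    have "arc_sum t u col' Z d = sg (col y) * sg s * (of_bool (t z = d) - of_bool (u z = d))
        + (sg (col y) * (of_bool (t y = d) - of_bool (u y = d)) + arc_sum t u col' (Z - {y, z}) d)"
      using Z sgz by (subst Y(1)) (simp add: arc_sum_insert, simp add: col'_def)
    also have "\<dots> = sg (col y) * (of_bool (a = d) - of_bool (b = d)) + arc_sum t u col' (Z - {y, z}) d"
      unfolding eq[of d] by (simp only: algebra_simps)
    also have "arc_sum t u col' (Z - {y, z}) d = arc_sum (t(y := a)) (u(y := b)) col (Z - {y, z}) d"
      by (intro arc_sum_cong) (auto simp: col'_def)
    also have "sg (col y) * (of_bool (a = d) - of_bool (b = d)) + \<dots> = arc_sum (t(y := a)) (u(y := b)) col (Z - {z}) d"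
      using Z by (subst Y(2)) (simp add: arc_sum_insert)
    finally show ?thesis .
  qed
  then show ?thesis using col by metis
qed

text \<open>Merging two arcs at a shared end keeps all sums. When no two arcs share an end, every
  \<open>d\<close> meets at most one arc.\<close>

lemma balanced_orientation:
  fixes Z :: "'e set" and t u :: "'e \<Rightarrow> 'd"
  assumes "finite Z"
  shows "\<exists>col. \<forall>d. \<bar>arc_sum t u col Z d\<bar> \<le> 1"
  using assms
proof (induction "card Z" arbitrary: Z t u rule: less_induct)
  case less
  have IH: "\<exists>col. \<forall>d. \<bar>arc_sum t' u' col (Z - {z}) d\<bar> \<le> 1" if "z \<in> Z" for z and t' u' :: "'e \<Rightarrow> 'd"
    using less.hyps[of "Z - {z}" t' u'] card_Diff1_less[OF less.prems that] less.prems by blast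
  show ?case
  proof (cases "\<exists>y \<in> Z. \<exists>z \<in> Z. y \<noteq> z \<and> {t y, u y} \<inter> {t z, u z} \<noteq> {}")
    case True
    then obtain y z where yz: "y \<in> Z" "z \<in> Z" "y \<noteq> z" "{t y, u y} \<inter> {t z, u z} \<noteq> {}" by blast
    note M = merge_arcs[OF less.prems yz(1-3) IH[OF yz(2)]]
    \<comment> \<open>If the \<open>t\<close> end of one arc is the \<open>u\<close> end of the
      other, equal signs cancel there; if the shared ends are of the same kind, opposite signs do.
      The merged arc joins the two remaining ends.\<close>
    consider "u y = t z" | "t y = u z" | "u y = u z" | "t y = t z" using yz(4) by auto
    then show ?thesis
    proof cases
      case 1 then show ?thesis by (intro M[of "t y" "u z" t u True]) (auto simp: sg_def)
    next
      case 2 then show ?thesis by (intro M[of "t z" "u y" t u True]) (auto simp: sg_def)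
    next
      case 3 then show ?thesis by (intro M[of "t y" "t z" t u False]) (auto simp: sg_def)
    next
      case 4 then show ?thesis by (intro M[of "u z" "u y" t u False]) (auto simp: sg_def)
    qed
  next
    case False
    have "\<bar>arc_sum t u (\<lambda>_. True) Z d\<bar> \<le> 1" for d
    proof (cases "\<exists>z \<in> Z. d \<in> {t z, u z}")
      case True
      then obtain z where z: "z \<in> Z" "d \<in> {t z, u z}" by blast
      have 0: "arc_sum t u (\<lambda>_. True) (Z - {z}) d = 0"
        unfolding arc_sum_def
      proof (intro sum.neutral ballI)
        fix y assume "y \<in> Z - {z}"
        then have "{t y, u y} \<inter> {t z, u z} = {}" using False z(1) by blast
        then have "t y \<noteq> d" "u y \<noteq> d" using z(2) by blast+
        then show "sg True * (of_bool (t y = d) - of_bool (u y = d)) = 0" by simp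
      qed
      have "arc_sum t u (\<lambda>_. True) Z d = arc_sum t u (\<lambda>_. True) (insert z (Z - {z})) d"
        using z by (simp add: insert_absorb)
      also have "\<dots> = sg True * (of_bool (t z = d) - of_bool (u z = d))"
        using less.prems 0 by (subst arc_sum_insert) auto
      finally show ?thesis by (simp add: sg_def)
    next
      case False
      then have "arc_sum t u (\<lambda>_. True) Z d = 0"
        unfolding arc_sum_def by (intro sum.neutral) auto
      then show ?thesis by simp
    qed
    then show ?thesis by blast
  qed
qed

section \<open>Double trees without tight subsets\<close>

definition deg :: "('e \<times> bool \<Rightarrow> 'v) \<Rightarrow> 'e set \<Rightarrow> 'v \<Rightarrow> nat" where
  "deg h P v = card {q \<in> P \<times> UNIV. h q = v}"

lemma sum_deg:
  assumes "finite P" "finite V" "vset h P \<subseteq> V"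
  shows "(\<Sum>v \<in> V. deg h P v) = 2 * card P"
proof -
  have "(\<Sum>v \<in> V. deg h P v) = card (\<Union>v \<in> V. {q \<in> P \<times> UNIV. h q = v})"
    unfolding deg_def using assms by (subst card_UN_disjoint) auto
  also have "(\<Union>v \<in> V. {q \<in> P \<times> UNIV. h q = v}) = P \<times> (UNIV :: bool set)"
    using assms by (auto simp: vset_def)
  finally show ?thesis by (simp add: card_cartesian_product)
qed

text \<open>The bound 3 sets aside the pair of parallel edges, which has no tight proper subset
  either and is treated in \<open>pieces_arc\<close>.\<close>

definition prime_double_tree :: "('e \<times> bool \<Rightarrow> 'v) \<Rightarrow> 'e set \<Rightarrow> bool" where
  "prime_double_tree h P \<longleftrightarrow> double_tree h P \<and> 3 \<le> card (vset h P) \<and>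
     (\<forall>Q \<subseteq> P. Q \<noteq> {} \<longrightarrow> Q \<noteq> P \<longrightarrow> card Q + 2 \<noteq> 2 * card (vset h Q))"

lemma prime_double_treeD:
  assumes "prime_double_tree h P" "Q \<subseteq> P" "Q \<noteq> {}" "Q \<noteq> P"
  shows "card Q + 3 \<le> 2 * card (vset h Q)"
proof -
  have "card Q + 2 \<le> 2 * card (vset h Q)"
    using assms by (intro sparseD[of 2 h P]) (auto simp: prime_double_tree_def double_tree_def)
  moreover have "card Q + 2 \<noteq> 2 * card (vset h Q)" using assms by (auto simp: prime_double_tree_def)
  ultimately show ?thesis by linarith
qed

lemma inj_on_fst_star:
  assumes "sparse k h P"
  shows "inj_on fst {q \<in> P \<times> UNIV. h q = v}"
proof (rule inj_onI)
  fix q q' assume q: "q \<in> {q \<in> P \<times> UNIV. h q = v}" "q' \<in> {q \<in> P \<times> UNIV. h q = v}" "fst q = fst q'"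
  obtain e i i' where e: "q = (e, i)" "q' = (e, i')" using q(3) by (metis prod.collapse)
  have "e \<in> P" "h (e, i) = h (e, i')" using q e by auto
  then have "i' \<noteq> (\<not> i)" using sparse_loopless[OF assms, of e i] by (cases i; cases i') auto
  then show "q = q'" using e by auto
qed

text \<open>Deleting the star of a vertex of degree at most 2 costs at most 2 edges and at least one
  vertex, so the rest would violate the strict bound for proper subsets.\<close>

lemma prime_double_tree_deg:
  assumes P: "prime_double_tree h P" and v: "v \<in> vset h P"
  shows "3 \<le> deg h P v"
proof (rule ccontr)
  assume d: "\<not> 3 \<le> deg h P v"
  have dt: "finite P" "sparse 2 h P" "card P + 2 = 2 * card (vset h P)" "3 \<le> card (vset h P)"
    using P by (auto simp: prime_double_tree_def double_tree_def)
  let ?S = "fst ` {q \<in> P \<times> UNIV. h q = v}"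
  have cS: "card ?S = deg h P v"
    unfolding deg_def by (rule card_image[OF inj_on_fst_star[OF dt(2)]])
  let ?Q = "P - ?S"
  have S: "?S \<subseteq> P" by auto
  have inS: "e \<in> ?S" if "e \<in> P" "h (e, i) = v" for e i
    using that by (intro image_eqI[of _ fst "(e, i)"]) auto
  have "finite ?S" using S dt(1) by (rule finite_subset)
  then have cQ: "card ?Q + deg h P v = card P"
    using card_Diff_subset[of ?S P] card_mono[OF dt(1) S] S unfolding cS by linarith
  have vQ: "vset h ?Q \<subseteq> vset h P - {v}"
  proof
    fix x assume "x \<in> vset h ?Q"
    then obtain e i where e: "e \<in> P" "e \<notin> ?S" "x = h (e, i)" by (auto simp: vset_def)
    then have "x \<noteq> v" using inS by blast
    then show "x \<in> vset h P - {v}" using e in_vsetI[of e P h i] by auto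
  qed
  have cv: "card (vset h ?Q) + 1 \<le> card (vset h P)"
  proof -
    have "card (vset h ?Q) \<le> card (vset h P - {v})" using vQ dt(1) by (intro card_mono) auto
    moreover have "card (vset h P - {v}) + 1 = card (vset h P)"
      using v dt(1) by (metis Suc_eq_plus1 card.remove finite_vset)
    ultimately show ?thesis by linarith
  qed
  \<comment> \<open>Three vertices mean at least 4 edges, so the star is not all of
    \<open>P\<close>.\<close>
  have "card ?Q \<noteq> 0" using cQ d dt(3,4) by linarith
  then have "?Q \<noteq> {}" by (metis card.empty)
  moreover have "?Q \<noteq> P"
  proof -
    obtain e i where "e \<in> P" "h (e, i) = v" using v by (auto simp: vset_def)
    then show ?thesis using inS by blast
  qed
  ultimately have "card ?Q + 3 \<le> 2 * card (vset h ?Q)" by (intro prime_double_treeD[OF P]) auto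
  then show False using cv cQ d dt by linarith
qed

text \<open>Two parallel edges would be a tight set on 2 vertices, and a proper one because
  \<open>P\<close> has at least 4 edges.\<close>

lemma prime_double_tree_simple:
  assumes P: "prime_double_tree h P" and e: "e \<in> P" "f \<in> P" "e \<noteq> f" "h (e, i) = h (f, j)"
  shows "h (e, \<not> i) \<noteq> h (f, \<not> j)"
proof
  assume eq: "h (e, \<not> i) = h (f, \<not> j)"
  have dt: "card P + 2 = 2 * card (vset h P)" "3 \<le> card (vset h P)"
    using P by (auto simp: prime_double_tree_def double_tree_def)
  have "vset h {e, f} = {h (e, i), h (e, \<not> i)}"
    using eq e vset_insert[of h e "{f}" i] vset_insert[of h f "{}" j] by auto
  then have c: "card (vset h {e, f}) \<le> 2" by (simp add: card_insert_if)
  have "card {e, f} = 2" using e by simp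
  then have "{e, f} \<noteq> P" using dt by auto
  then have "card {e, f} + 3 \<le> 2 * card (vset h {e, f})" using e by (intro prime_double_treeD[OF P]) auto
  then show False using c \<open>card {e, f} = 2\<close> by linarith
qed

text \<open>The name \<open>e1\<close> is reused for the new edge between the other ends of
  \<open>e1\<close> and \<open>e3\<close>. A set that contains it has one edge more than its rest,
  and the slack that primeness grants to the rest pays for this edge.\<close>

lemma double_tree_reduce:
  assumes P: "prime_double_tree h P"
    and star: "{q \<in> P \<times> UNIV. h q = w} = {(e1, i1), (e2, i2), (e3, i3)}"
    and d: "e1 \<noteq> e2" "e1 \<noteq> e3" "e2 \<noteq> e3"
  shows "double_tree (h((e1, i1) := h (e3, \<not> i3))) (P - {e2, e3})"
proof -
  let ?h = "h((e1, i1) := h (e3, \<not> i3))" and ?P = "P - {e2, e3}"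
  have dt: "finite P" "sparse 2 h P" "card P + 2 = 2 * card (vset h P)" "3 \<le> card (vset h P)"
    using P by (auto simp: prime_double_tree_def double_tree_def)
  have e: "e1 \<in> P" "e2 \<in> P" "e3 \<in> P" "h (e1, i1) = w" "h (e2, i2) = w" "h (e3, i3) = w"
    using star by blast+
  have w: "w \<notin> vset h (P - {e1, e2, e3})"
  proof
    assume "w \<in> vset h (P - {e1, e2, e3})"
    then obtain e i where q: "e \<in> P" "e \<notin> {e1, e2, e3}" "h (e, i) = w" by (auto simp: vset_def)
    then have "(e, i) \<in> {q \<in> P \<times> UNIV. h q = w}" by auto
    then show False unfolding star using q(2) by auto
  qed
  \<comment> \<open>Since \<open>e1\<close> and \<open>e3\<close> are not parallel, the new edge is
    not a loop.\<close>
  have xz: "h (e1, \<not> i1) \<noteq> h (e3, \<not> i3)"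
    using prime_double_tree_simple[OF P, of e1 e3 i1 i3] e d by auto
  have nw: "h (e1, \<not> i1) \<noteq> w" "h (e3, \<not> i3) \<noteq> w"
    using sparse_loopless[OF dt(2), of e1 i1] sparse_loopless[OF dt(2), of e3 i3] e by auto
  have vR: "vset ?h R = {h (e1, \<not> i1), h (e3, \<not> i3)} \<union> vset h (R - {e1})" if "e1 \<in> R" for R
  proof -
    have "vset ?h (insert e1 (R - {e1})) = {?h (e1, i1), ?h (e1, \<not> i1)} \<union> vset ?h (R - {e1})"
      by (rule vset_insert)
    also have "vset ?h (R - {e1}) = vset h (R - {e1})" by (rule vset_cong) auto
    finally show ?thesis using that by (simp add: insert_absorb insert_commute fun_upd_def)
  qed
  have sp: "sparse 2 ?h ?P"
    unfolding sparse_def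
  proof (intro allI impI)
    fix R assume R: "R \<subseteq> ?P" "R \<noteq> {}"
    have fR: "finite R" using R dt(1) finite_subset by blast
    show "card R + 2 \<le> 2 * card (vset ?h R)"
    proof (cases "e1 \<in> R")
      case False
      then have "vset ?h R = vset h R" by (intro vset_cong) auto
      then show ?thesis using sparseD[OF dt(2), of R] R by auto
    next
      case True
      let ?R = "R - {e1}"
      have c: "card R = card ?R + 1" using fR True by (metis Suc_eq_plus1 card.remove)
      show ?thesis
      proof (cases "?R = {}")
        case True
        then have "vset ?h R = {h (e1, \<not> i1), h (e3, \<not> i3)}" "card ?R = 0"
          using vR[OF \<open>e1 \<in> R\<close>] unfolding True by simp_all
        then show ?thesis using c xz by simp
      next
        case False
        have "card ?R + 3 \<le> 2 * card (vset h ?R)"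
          using R False e by (intro prime_double_treeD[OF P]) auto
        moreover have "card (vset h ?R) \<le> card (vset ?h R)"
          using vR[OF True] fR by (intro card_mono) auto
        ultimately show ?thesis using c by linarith
      qed
    qed
  qed
  have e1P: "e1 \<in> ?P" using e d by auto
  have "vset ?h ?P \<subseteq> vset h P - {w}"
  proof -
    have "?P - {e1} = P - {e1, e2, e3}" by auto
    then have "vset ?h ?P = {h (e1, \<not> i1), h (e3, \<not> i3)} \<union> vset h (P - {e1, e2, e3})"
      using vR[OF e1P] by simp
    then show ?thesis using w nw e in_vsetI[of e1 P h] in_vsetI[of e3 P h] vset_mono[of "P - {e1, e2, e3}" P h] by auto
  qed
  moreover have "w \<in> vset h P" using e in_vsetI[of e1 P h i1] by auto
  \<comment> \<open>The vertex \<open>w\<close> disappears along with two edges, so at most the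
    tight number of vertices is left; sparsity shows that it is attained.\<close>
  ultimately have "card (vset ?h ?P) + 1 \<le> card (vset h P)"
  proof -
    assume *: "vset ?h ?P \<subseteq> vset h P - {w}" "w \<in> vset h P"
    have "card (vset ?h ?P) \<le> card (vset h P - {w})" using * dt(1) by (intro card_mono) auto
    moreover have "card (vset h P - {w}) + 1 = card (vset h P)"
      using * dt(1) by (metis Suc_eq_plus1 card.remove finite_vset)
    ultimately show ?thesis by linarith
  qed
  moreover have "card ?P + 2 = card P" 
  proof -
    have "card ?P = card P - card {e2, e3}" using e by (intro card_Diff_subset) auto
    moreover have "card {e2, e3} \<le> card P" using e dt(1) by (intro card_mono) auto
    ultimately show ?thesis using d by simp
  qed
  moreover have "card ?P + 2 \<le> 2 * card (vset ?h ?P)" using sparseD[OF sp, of ?P] e1P by blast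
  ultimately have "card ?P + 2 = 2 * card (vset ?h ?P)" using dt by linarith
  then show ?thesis using sp dt(1) e1P by (auto simp: double_tree_def)
qed

section \<open>Balancing two trees\<close>

text \<open>The class \<open>lab q\<close> is kept apart from the vertex \<open>h q\<close>: it
  remembers the original vertex whose degrees are to be balanced, while contraction merges vertices.
  \<open>A\<close> holds the classes still under control.\<close>

definition active :: "('e \<times> bool \<Rightarrow> 'c) \<Rightarrow> 'c set \<Rightarrow> 'e set \<Rightarrow> ('e \<times> bool) set" where
  "active lab A P = {q \<in> P \<times> UNIV. lab q \<in> A}"

definition hubs :: "('e \<times> bool \<Rightarrow> 'v) \<Rightarrow> ('e \<times> bool \<Rightarrow> 'c) \<Rightarrow> 'c set \<Rightarrow> 'e set \<Rightarrow> 'v set" where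
  "hubs h lab A P = h ` active lab A P"

definition half_sum :: "('e \<times> bool \<Rightarrow> 'c) \<Rightarrow> ('e \<Rightarrow> bool) \<Rightarrow> 'e set \<Rightarrow> 'c \<Rightarrow> int" where
  "half_sum lab col E c = (\<Sum>q \<in> E \<times> UNIV. of_bool (lab q = c) * sg (col (fst q)))"

text \<open>
  The last condition says that the classes in \<open>B\<close> and the pieces in which they occur form a hyperforest,
  except that classes at the same vertex of a piece count only once there (for an empty set of hubs the
  truncated difference is 0).
\<close>

definition pieces ::
    "('e \<times> bool \<Rightarrow> 'v) \<Rightarrow> ('e \<times> bool \<Rightarrow> 'c) \<Rightarrow> 'c set \<Rightarrow> 'e set set \<Rightarrow> bool" where
  "pieces h lab A PP \<longleftrightarrow> finite PP \<and> pairwise disjnt PP \<and> (\<forall>P \<in> PP. double_tree h P) \<and> finite A \<and>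
     (\<forall>B \<subseteq> A. B \<noteq> {} \<longrightarrow> (\<Sum>P \<in> PP. card (hubs h lab B P) - 1) + 1 \<le> card B)"

text \<open>
  \<open>Z\<close> collects the sign choices made so far: the arc \<open>z\<close> contributes its sign to class \<open>t z\<close> and the opposite
  sign to \<open>u z\<close>. A class that has been given up must still be balanced with respect to the arcs that were
  created before, hence the last clause.
\<close>

definition balanceable ::
    "('e \<times> bool \<Rightarrow> 'v) \<Rightarrow> ('e \<times> bool \<Rightarrow> 'c) \<Rightarrow> 'c set \<Rightarrow> 'e set set \<Rightarrow>
     ('e \<Rightarrow> 'c option) \<Rightarrow> ('e \<Rightarrow> 'c option) \<Rightarrow> 'e set \<Rightarrow> bool" where
  "balanceable h lab A PP t u Z \<longleftrightarrow> (\<exists>col.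
     (\<forall>P \<in> PP. \<forall>s. sparse 1 h {e \<in> P. col e = s}) \<and>
     (\<forall>c \<in> A. \<bar>half_sum lab col (\<Union>PP) c + arc_sum t u col Z (Some c)\<bar> \<le> 6) \<and>
     (\<forall>c. c \<notin> A \<longrightarrow> \<bar>arc_sum t u col Z (Some c)\<bar> \<le> 1))"

lemma finite_active [simp]: "finite P \<Longrightarrow> finite (active lab A P)"
  by (simp add: active_def)

lemma hubs_subset_vset: "hubs h lab A P \<subseteq> vset h P"
  by (auto simp: hubs_def active_def vset_def)

lemma finite_hubs [simp]: "finite P \<Longrightarrow> finite (hubs h lab A P)"
  by (simp add: hubs_def)

text \<open>
  By \<open>irr\<close>, the edges at vertices of degree 3 outside the hubs all lead to hubs, so sparsity bounds the number
  of these vertices; as the average degree is less than 4, this bounds the degrees of the hubs.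
\<close>

lemma card_active_le:
  assumes P: "prime_double_tree h P"
    and irr: "\<And>e i. e \<in> P \<Longrightarrow> h (e, i) \<notin> hubs h lab A P \<Longrightarrow> deg h P (h (e, i)) = 3 \<Longrightarrow>
      (e, \<not> i) \<in> active lab A P"
  shows "hubs h lab A P \<noteq> {}" "card (active lab A P) \<le> 6 * (card (hubs h lab A P) - 1)"
proof -
  define U where "U = hubs h lab A P"
  define V where "V = vset h P"
  define N where "N = {v \<in> V - U. deg h P v = 3}"
  have dt: "finite P" "sparse 2 h P" "card P + 2 = 2 * card V"
    using P by (auto simp: prime_double_tree_def double_tree_def V_def)
  have UV: "U \<subseteq> V" unfolding U_def V_def by (rule hubs_subset_vset)
  have fin: "finite V" "finite U" "finite N" using dt(1) by (auto simp: U_def V_def N_def)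
  have "active lab A P \<subseteq> (\<Union>v \<in> U. {q \<in> P \<times> UNIV. h q = v})"
    by (auto simp: U_def hubs_def active_def)
  then have "card (active lab A P) \<le> card (\<Union>v \<in> U. {q \<in> P \<times> UNIV. h q = v})"
    using dt(1) fin by (intro card_mono) auto
  also have "\<dots> \<le> (\<Sum>v \<in> U. deg h P v)" unfolding deg_def by (rule card_UN_le[OF fin(2)])
  finally have a: "card (active lab A P) \<le> (\<Sum>v \<in> U. deg h P v)" .
  have s1: "(\<Sum>v \<in> U. deg h P v) + (\<Sum>v \<in> V - U. deg h P v) = 2 * card P"
    using sum.subset_diff[OF UV fin(1), of "deg h P"] sum_deg[OF dt(1) fin(1)] by (simp add: V_def)
  \<comment> \<open>Outside the hubs every degree is at least 4, except at the vertices of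
    \<open>N\<close>, which are one short.\<close>
  have "(\<Sum>v \<in> V - U. 4 :: nat) \<le> (\<Sum>v \<in> V - U. deg h P v + of_bool (deg h P v = 3))"
  proof (rule sum_mono)
    fix v assume "v \<in> V - U"
    then have "3 \<le> deg h P v" using prime_double_tree_deg[OF P, of v] by (simp add: V_def)
    then show "4 \<le> deg h P v + of_bool (deg h P v = 3)" by (cases "deg h P v = 3") auto
  qed
  also have "\<dots> = (\<Sum>v \<in> V - U. deg h P v) + card N"
  proof -
    have "(\<Sum>v \<in> V - U. of_bool (deg h P v = 3)) = card N"
      using fin unfolding N_def by (simp add: of_bool_def sum.If_cases Int_def)
    then show ?thesis by (simp add: sum.distrib)
  qed
  finally have s2: "4 * card (V - U) \<le> (\<Sum>v \<in> V - U. deg h P v) + card N" by simp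
  have s3: "card (V - U) + card U = card V"
    using UV fin by (metis card_Diff_subset card_mono le_add_diff_inverse2)
  \<comment> \<open>The total degree is \<open>4 * card V - 4\<close>; what the other vertices do
    not use is left for the hubs.\<close>
  have s4: "(\<Sum>v \<in> U. deg h P v) + 4 \<le> 4 * card U + card N"
    using s1 s2 s3 dt(3) by linarith
  \<comment> \<open>Edges at \<open>N\<close> have their other ends in \<open>U\<close>, so there
    are \<open>3 * card N\<close> distinct ones, on at most \<open>card N + card U\<close> vertices.
    Sparsity then bounds \<open>card N\<close>.\<close>
  have n: "card N + 2 \<le> 2 * card U" if "N \<noteq> {}"
  proof -
    let ?H = "{q \<in> P \<times> UNIV. h q \<in> N}"
    have other: "h (e, \<not> i) \<in> U" if "e \<in> P" "h (e, i) \<in> N" for e i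
      using irr[OF that(1), of i] that(2) by (auto simp: N_def U_def hubs_def)
    have NU: "N \<inter> U = {}" by (auto simp: N_def)
    have "inj_on fst ?H"
    proof (rule inj_onI)
      fix q q' assume q: "q \<in> ?H" "q' \<in> ?H" "fst q = fst q'"
      obtain e i i' where e: "q = (e, i)" "q' = (e, i')" using q(3) by (metis prod.collapse)
      have "e \<in> P" "h (e, i) \<in> N" "h (e, i') \<in> N" using q e by auto
      then have "i' \<noteq> (\<not> i)" using other[of e i] NU by auto
      then show "q = q'" using e by auto
    qed
    then have "card (fst ` ?H) = card ?H" by (rule card_image)
    also have "card ?H = card (\<Union>v \<in> N. {q \<in> P \<times> UNIV. h q = v})"
      by (rule arg_cong[of _ _ card]) auto
    also have "\<dots> = (\<Sum>v \<in> N. deg h P v)"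
      unfolding deg_def using fin dt(1) by (subst card_UN_disjoint) auto
    also have "\<dots> = 3 * card N" by (simp add: N_def)
    finally have c: "card (fst ` ?H) = 3 * card N" .
    have "vset h (fst ` ?H) \<subseteq> N \<union> U"
    proof
      fix v assume "v \<in> vset h (fst ` ?H)"
      then obtain e i j where e: "e \<in> P" "h (e, i) \<in> N" "v = h (e, j)" by (auto simp: vset_def)
      have "j = i \<or> j = (\<not> i)" by auto
      then show "v \<in> N \<union> U" using e other by auto
    qed
    then have "card (vset h (fst ` ?H)) \<le> card (N \<union> U)" using fin by (intro card_mono) auto
    also have "\<dots> \<le> card N + card U" by (rule card_Un_le)
    finally have v: "card (vset h (fst ` ?H)) \<le> card N + card U" .
    have "card (fst ` ?H) + 2 \<le> 2 * card (vset h (fst ` ?H))"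
    proof (rule sparseD[OF dt(2)])
      have "card (fst ` ?H) \<noteq> 0" using c that fin by simp
      then show "fst ` ?H \<noteq> {}" by (metis card.empty)
    qed auto
    then show ?thesis using c v by linarith
  qed
  have "1 \<le> card U \<and> card (active lab A P) + 6 \<le> 6 * card U"
  proof (cases "N = {}")
    case True then show ?thesis using a s4 by simp
  next
    case False then show ?thesis using a s4 n by linarith
  qed
  then show "hubs h lab A P \<noteq> {}" "card (active lab A P) \<le> 6 * (card (hubs h lab A P) - 1)"
    unfolding U_def by auto
qed

section \<open>Moves on collections of pieces\<close>

lemma piecesD:
  assumes "pieces h lab A PP"
  shows "finite PP" "pairwise disjnt PP" "\<And>P. P \<in> PP \<Longrightarrow> double_tree h P" "finite A"
    "\<And>B. B \<subseteq> A \<Longrightarrow> B \<noteq> {} \<Longrightarrow> (\<Sum>P \<in> PP. card (hubs h lab B P) - 1) + 1 \<le> card B"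
    "\<And>P. P \<in> PP \<Longrightarrow> finite P" "\<And>P. P \<in> PP \<Longrightarrow> P \<noteq> {}"
    "\<And>P Q. P \<in> PP \<Longrightarrow> Q \<in> PP \<Longrightarrow> P \<noteq> Q \<Longrightarrow> P \<inter> Q = {}"
  using assms by (auto simp: pieces_def double_tree_def pairwise_def disjnt_def)

lemma hubs_cong:
  assumes "\<And>e i. e \<in> P \<Longrightarrow> h (e, i) = h' (e, i) \<and> lab (e, i) = lab' (e, i)"
  shows "hubs h lab A P = hubs h' lab' A P"
proof -
  have "active lab A P = active lab' A P" using assms by (auto simp: active_def)
  then show ?thesis unfolding hubs_def using assms by (intro image_cong) (auto simp: active_def)
qed

text \<open>Common frame of the moves. As the pieces are disjoint, a change inside \<open>P\<close>
  does not affect the others; only the hub count is global, and there the new parts may not use more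
  than \<open>P\<close> did. An empty \<open>QQ\<close> removes the piece.\<close>

lemma pieces_replace:
  assumes pc: "pieces h lab A PP" and P: "P \<in> PP"
    and QQ: "finite QQ" "pairwise disjnt QQ" "\<Union>QQ \<subseteq> P" "\<And>Q. Q \<in> QQ \<Longrightarrow> double_tree h' Q"
    and agree: "\<And>e i. e \<notin> P \<Longrightarrow> h' (e, i) = h (e, i) \<and> lab' (e, i) = lab (e, i)"
    and hubs: "\<And>B. B \<subseteq> A \<Longrightarrow> (\<Sum>Q \<in> QQ. card (hubs h' lab' B Q) - 1) \<le> card (hubs h lab B P) - 1"
  shows "pieces h' lab' A (QQ \<union> (PP - {P}))"
proof -
  note pD = piecesD[OF pc]
  have out: "e \<notin> P" if "R \<in> PP - {P}" "e \<in> R" for R e using pD(8)[of R P] that P by auto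
  have disj: "QQ \<inter> (PP - {P}) = {}"
  proof -
    have "False" if "Q \<in> QQ" "Q \<in> PP - {P}" for Q
      using QQ(3) out[OF that(2)] pD(7)[of Q] that by blast
    then show ?thesis by blast
  qed
  show ?thesis
    unfolding pieces_def
  proof (intro conjI ballI allI impI)
    show "finite (QQ \<union> (PP - {P}))" "finite A" using QQ pD by auto
    have "disjnt Q R" if "Q \<in> QQ" "R \<in> PP - {P}" for Q R
      using QQ(3) out[OF that(2)] that(1) by (auto simp: disjnt_def)
    then show "pairwise disjnt (QQ \<union> (PP - {P}))"
      using QQ(2) pD(2) unfolding pairwise_def by (blast intro: disjnt_sym)
  next
    fix R assume "R \<in> QQ \<union> (PP - {P})"
    then show "double_tree h' R"
    proof
      assume R: "R \<in> PP - {P}"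
      have "double_tree h R \<longleftrightarrow> double_tree h' R" using agree out[OF R] by (intro double_tree_cong) auto
      then show ?thesis using pD(3) R by auto
    qed (rule QQ(4))
  next
    fix B assume B: "B \<subseteq> A" "B \<noteq> {}"
    have "(\<Sum>R \<in> QQ \<union> (PP - {P}). card (hubs h' lab' B R) - 1) =
        (\<Sum>Q \<in> QQ. card (hubs h' lab' B Q) - 1) + (\<Sum>R \<in> PP - {P}. card (hubs h' lab' B R) - 1)"
      using QQ(1) pD(1) disj by (intro sum.union_disjoint) auto
    also have "(\<Sum>R \<in> PP - {P}. card (hubs h' lab' B R) - 1) = (\<Sum>R \<in> PP - {P}. card (hubs h lab B R) - 1)"
    proof (rule sum.cong[OF refl])
      fix R assume R: "R \<in> PP - {P}"
      have "hubs h' lab' B R = hubs h lab B R" using agree out[OF R] by (intro hubs_cong) auto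
      then show "card (hubs h' lab' B R) - 1 = card (hubs h lab B R) - 1" by simp
    qed
    also have "(\<Sum>Q \<in> QQ. card (hubs h' lab' B Q) - 1) + \<dots> \<le> 
       card (hubs h lab B P) - 1 + (\<Sum>R \<in> PP - {P}. card (hubs h lab B R) - 1)"
      using hubs[OF B(1)] by simp
    also have "\<dots> = (\<Sum>R \<in> PP. card (hubs h lab B R) - 1)"
      using P pD(1) by (simp add: sum.remove)
    finally show "(\<Sum>R \<in> QQ \<union> (PP - {P}). card (hubs h' lab' B R) - 1) + 1 \<le> card B"
      using pD(5)[OF B] by linarith
  qed
qed

text \<open>The subtracted 1 makes the measure fall when a piece is split in two, although no edge
  is lost.\<close>

definition size_of :: "'e set set \<Rightarrow> nat" where
  "size_of PP = (\<Sum>P \<in> PP. 2 * card P - 1)"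

lemma size_of_replace:
  assumes pc: "pieces h lab A PP" and P: "P \<in> PP" and QQ: "finite QQ"
    and less: "(\<Sum>Q \<in> QQ. 2 * card Q - 1) < 2 * card P - 1"
  shows "size_of (QQ \<union> (PP - {P})) < size_of PP"
proof -
  note pD = piecesD[OF pc]
  have "size_of (QQ \<union> (PP - {P})) \<le> (\<Sum>Q \<in> QQ. 2 * card Q - 1) + (\<Sum>Q \<in> PP - {P}. 2 * card Q - 1)"
    unfolding size_of_def using QQ pD(1)
    by (metis (no_types, lifting) sum.union_inter finite_Diff le_add1)
  also have "\<dots> < (2 * card P - 1) + (\<Sum>Q \<in> PP - {P}. 2 * card Q - 1)" using less by simp
  also have "\<dots> = size_of PP" unfolding size_of_def using P pD(1) by (simp add: sum.remove)
  finally show ?thesis .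
qed

text \<open>Colourings of \<open>Q\<close> and of the contracted rest combine by
  \<open>sparse_expand\<close>. The edges and their classes stay the same, so the balance carries
  over unchanged.\<close>

lemma pieces_split:
  fixes h :: "'e \<times> bool \<Rightarrow> 'v"
  assumes pc: "pieces h lab A PP" and P: "P \<in> PP"
    and Q: "Q \<subseteq> P" "Q \<noteq> {}" "Q \<noteq> P" "card Q + 2 = 2 * card (vset h Q)"
  obtains h' :: "'e \<times> bool \<Rightarrow> 'v" where "pieces h' lab A ({Q, P - Q} \<union> (PP - {P}))"
    "size_of ({Q, P - Q} \<union> (PP - {P})) < size_of PP"
    "\<And>t u Z. balanceable h' lab A ({Q, P - Q} \<union> (PP - {P})) t u Z \<Longrightarrow> balanceable h lab A PP t u Z"
proof -
  note pD = piecesD[OF pc]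
  have fP: "finite P" by (rule pD(6)[OF P])
  have fQ: "finite Q" using fP Q(1) by (rule finite_subset[rotated])
  define X where "X = vset h Q"
  obtain x where x: "x \<in> X" using Q(2) vset_eq_empty_iff[of h Q] unfolding X_def by blast
  \<comment> \<open>An edge lies in one piece only, so a single map can serve all pieces,
    contracting on \<open>P - Q\<close> alone.\<close>
  define h' where "h' = (\<lambda>q. if fst q \<in> P - Q then contract X x h q else h q)"
  have dt: "double_tree h Q" "double_tree (contract X x h) (P - Q)"
    using double_tree_contract[OF pD(3)[OF P] Q(1,3,2,4), of x] x unfolding X_def by auto
  have dt': "double_tree h' Q" "double_tree h' (P - Q)"
    using dt double_tree_cong[of Q h h'] double_tree_cong[of "P - Q" "contract X x h" h']
    by (auto simp: h'_def)
  have neq: "Q \<noteq> P - Q" using Q(2) by auto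
  \<comment> \<open>Hubs in \<open>X\<close> count separately only for \<open>Q\<close>; for
    \<open>P - Q\<close> they collapse to \<open>x\<close>. This one additional hub is absorbed by
    the second subtracted 1.\<close>
  have hb: "(card (hubs h' lab B Q) - 1) + (card (hubs h' lab B (P - Q)) - 1) \<le> card (hubs h lab B P) - 1" for B
  proof -
    let ?U = "hubs h lab B P"
    have 1: "hubs h' lab B Q \<subseteq> ?U \<inter> X"
      using Q(1) by (auto simp: hubs_def active_def h'_def X_def vset_def)
    have 2: "hubs h' lab B (P - Q) \<subseteq> (?U - X) \<union> (if ?U \<inter> X = {} then {} else {x})"
      by (auto simp: hubs_def active_def h'_def contract_def)
    have fU: "finite ?U" using fP by simp
    have c1: "card (hubs h' lab B Q) \<le> card (?U \<inter> X)" using 1 fU by (intro card_mono) auto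
    have c2: "card (hubs h' lab B (P - Q)) \<le> card ((?U - X) \<union> (if ?U \<inter> X = {} then {} else {x}))"
      using 2 fU by (intro card_mono) auto
    have c3: "card ?U = card (?U \<inter> X) + card (?U - X)"
      using fU by (metis card_Diff_subset_Int card_mono finite_Int inf_le1 le_add_diff_inverse)
    show ?thesis
    proof (cases "?U \<inter> X = {}")
      case True
      then show ?thesis using c1 c2 c3 by simp
    next
      case False
      then have "card (?U \<inter> X) \<ge> 1" using fU by (simp add: Suc_le_eq card_gt_0_iff)
      moreover have "card (hubs h' lab B (P - Q)) \<le> card (?U - X) + 1"
        using c2 False card_Un_le[of "?U - X" "{x}"] by simp
      ultimately show ?thesis using c1 c3 by linarith
    qed
  qed
  have pc': "pieces h' lab A ({Q, P - Q} \<union> (PP - {P}))"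
  proof (rule pieces_replace[OF pc P])
    show "pairwise disjnt {Q, P - Q}" by (auto simp: pairwise_def disjnt_def)
    show "(\<Sum>Q \<in> {Q, P - Q}. card (hubs h' lab B Q) - 1) \<le> card (hubs h lab B P) - 1" for B
      using hb[of B] neq by simp
  qed (use Q(1) dt' in \<open>auto simp: h'_def\<close>)
  have sz: "size_of ({Q, P - Q} \<union> (PP - {P})) < size_of PP"
  proof (rule size_of_replace[OF pc P])
    have "card P = card Q + card (P - Q)" using Q(1) fP fQ
      by (simp add: card_Diff_subset card_mono)
    moreover have "card Q > 0" "card (P - Q) > 0" using Q fP fQ by (auto simp: card_gt_0_iff)
    ultimately show "(\<Sum>Q \<in> {Q, P - Q}. 2 * card Q - 1) < 2 * card P - 1" using neq by simp
  qed simp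
  have UN: "\<Union>({Q, P - Q} \<union> (PP - {P})) = \<Union>PP" using P Q(1) by auto
  have "balanceable h lab A PP t u Z" if bal: "balanceable h' lab A ({Q, P - Q} \<union> (PP - {P})) t u Z" for t u Z
  proof -
    obtain col where col: "\<And>R s. R \<in> {Q, P - Q} \<union> (PP - {P}) \<Longrightarrow> sparse 1 h' {e \<in> R. col e = s}"
      "\<forall>c \<in> A. \<bar>half_sum lab col (\<Union>PP) c + arc_sum t u col Z (Some c)\<bar> \<le> 6"
      "\<forall>c. c \<notin> A \<longrightarrow> \<bar>arc_sum t u col Z (Some c)\<bar> \<le> 1"
      using bal unfolding balanceable_def UN by blast
    have "sparse 1 h {e \<in> R. col e = s}" if R: "R \<in> PP" for R s
    proof (cases "R = P")
      case False
      then have "e \<notin> P" if "e \<in> R" for e using pD(8)[of R P] R P that by auto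
      then have "sparse 1 h {e \<in> R. col e = s} \<longleftrightarrow> sparse 1 h' {e \<in> R. col e = s}"
        by (intro sparse_cong) (auto simp: h'_def)
      then show ?thesis using col(1)[of R] R False by auto
    next
      case True
      let ?F = "{e \<in> P. col e = s}"
      have "sparse 1 h {e \<in> ?F. e \<in> Q} \<longleftrightarrow> sparse 1 h' {e \<in> ?F. e \<in> Q}"
        by (intro sparse_cong) (auto simp: h'_def)
      moreover have "{e \<in> ?F. e \<in> Q} = {e \<in> Q. col e = s}" using Q(1) by auto
      ultimately have 1: "sparse 1 h {e \<in> ?F. e \<in> Q}" using col(1)[of Q s] by simp
      have "sparse 1 (contract X x h) (?F - Q) \<longleftrightarrow> sparse 1 h' (?F - Q)"
        by (intro sparse_cong) (auto simp: h'_def)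
      moreover have "?F - Q = {e \<in> P - Q. col e = s}" by auto
      ultimately have 2: "sparse 1 (contract X x h) (?F - Q)" using col(1)[of "P - Q" s] by simp
      show ?thesis unfolding True
        using fP x by (intro sparse_expand[OF _ 1 2]) (auto simp: X_def)
    qed
    then show ?thesis using col(2,3) unfolding balanceable_def by blast
  qed
  then show ?thesis using that[OF pc' sz] by blast
qed

lemma half_sum_insert:
  assumes "finite E" "e \<notin> E"
  shows "half_sum lab col (insert e E) c =
    (of_bool (lab (e, i) = c) + of_bool (lab (e, \<not> i) = c)) * sg (col e) + half_sum lab col E c"
proof -
  have eq: "insert e E \<times> UNIV = insert (e, i) (insert (e, \<not> i) (E \<times> UNIV))" by (cases i) auto
  have "(e, i) \<notin> insert (e, \<not> i) (E \<times> UNIV)" "(e, \<not> i) \<notin> E \<times> UNIV" using assms by auto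
  then show ?thesis unfolding half_sum_def eq using assms(1) by (simp add: ring_distribs)
qed

lemma half_sum_cong:
  fixes E :: "'e set"
  assumes "\<And>e i. e \<in> E \<Longrightarrow> lab (e, i) = lab' (e, i)" "\<And>e. e \<in> E \<Longrightarrow> col e = col' e"
  shows "half_sum lab col E c = half_sum lab' col' E c"
  unfolding half_sum_def
proof (rule sum.cong[OF refl])
  fix q :: "'e \<times> bool" assume "q \<in> E \<times> UNIV"
  then have "lab q = lab' q" "col (fst q) = col' (fst q)"
    using assms(1)[of "fst q" "snd q"] assms(2)[of "fst q"] by (auto simp: mem_Times_iff)
  then show "of_bool (lab q = c) * sg (col (fst q)) = of_bool (lab' q = c) * sg (col' (fst q))" by simp
qed

text \<open>The vertex \<open>w\<close> of degree 3 is not a hub and the far half of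
  \<open>e2\<close> is inactive, so no controlled class notices which tree receives
  \<open>e2\<close>. The other two edges at \<open>w\<close> become one edge, whose colour both
  inherit.\<close>

lemma pieces_reduce:
  fixes h :: "'e \<times> bool \<Rightarrow> 'v" and lab :: "'e \<times> bool \<Rightarrow> 'c"
  assumes pc: "pieces h lab A PP" and P: "P \<in> PP" "prime_double_tree h P"
    and e2: "e2 \<in> P" "h (e2, i2) \<notin> hubs h lab A P" "deg h P (h (e2, i2)) = 3"
      "(e2, \<not> i2) \<notin> active lab A P"
  obtains h' :: "'e \<times> bool \<Rightarrow> 'v" and lab' :: "'e \<times> bool \<Rightarrow> 'c" and P' where
    "pieces h' lab' A ({P'} \<union> (PP - {P}))" "P' \<subseteq> P"
    "size_of ({P'} \<union> (PP - {P})) < size_of PP"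
    "\<And>t u Z. Z \<inter> \<Union>PP = {} \<Longrightarrow> balanceable h' lab' A ({P'} \<union> (PP - {P})) t u Z \<Longrightarrow>
      balanceable h lab A PP t u Z"
proof -
  note pD = piecesD[OF pc]
  define w where "w = h (e2, i2)"
  let ?S = "{q \<in> P \<times> UNIV. h q = w}"
  have fP: "finite P" by (rule pD(6)[OF P(1)])
  have sp: "sparse 2 h P" using P(2) by (auto simp: prime_double_tree_def double_tree_def)
  have "(e2, i2) \<in> ?S" using e2 by (auto simp: w_def)
  then have "card (?S - {(e2, i2)}) = 2" using e2(3) fP unfolding deg_def w_def by simp
  then obtain q1 q3 where q: "?S - {(e2, i2)} = {q1, q3}" "q1 \<noteq> q3" by (auto simp: card_2_iff)
  obtain e1 i1 e3 i3 where q13: "q1 = (e1, i1)" "q3 = (e3, i3)" by (metis surj_pair)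
  have "?S = insert (e2, i2) (?S - {(e2, i2)})"
    using \<open>(e2, i2) \<in> ?S\<close> by (rule insert_Diff[symmetric])
  then have star: "?S = {(e1, i1), (e2, i2), (e3, i3)}"
    unfolding q(1) q13 by (simp add: insert_commute)
  have inj: "inj_on fst ?S" by (rule inj_on_fst_star[OF sp])
  have d: "e1 \<noteq> e2" "e1 \<noteq> e3" "e2 \<noteq> e3"
  proof -
    have "(e1, i1) \<noteq> (e2, i2)" "(e3, i3) \<noteq> (e2, i2)" "(e1, i1) \<noteq> (e3, i3)" using q q13 by auto
    moreover have "(e1, i1) \<in> ?S" "(e2, i2) \<in> ?S" "(e3, i3) \<in> ?S" unfolding star by auto
    ultimately show "e1 \<noteq> e2" "e1 \<noteq> e3" "e2 \<noteq> e3"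
      using inj_onD[OF inj, of "(e1, i1)" "(e2, i2)"] inj_onD[OF inj, of "(e1, i1)" "(e3, i3)"]
        inj_onD[OF inj, of "(e2, i2)" "(e3, i3)"] by fastforce+
  qed
  have "(e1, i1) \<in> ?S" "(e3, i3) \<in> ?S" unfolding star by simp_all
  then have e: "e1 \<in> P" "e3 \<in> P" "h (e1, i1) = w" "h (e3, i3) = w" by simp_all
  have nw: "h (e1, \<not> i1) \<noteq> w" "h (e2, \<not> i2) \<noteq> w" "h (e3, \<not> i3) \<noteq> w"
    using sparse_loopless[OF sp, of e1 i1] sparse_loopless[OF sp, of e2 i2]
      sparse_loopless[OF sp, of e3 i3] e e2 by (auto simp: w_def)
  have wout: "w \<notin> vset h (P - {e1, e2, e3})"
  proof
    assume "w \<in> vset h (P - {e1, e2, e3})"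
    then obtain e i where q: "e \<in> P" "e \<notin> {e1, e2, e3}" "h (e, i) = w" by (auto simp: vset_def)
    then have "(e, i) \<in> ?S" by auto
    then show False unfolding star using q(2) by auto
  qed
  have inact: "lab (e1, i1) \<notin> A" "lab (e2, i2) \<notin> A" "lab (e3, i3) \<notin> A" "lab (e2, \<not> i2) \<notin> A"
  proof -
    have *: "lab (f, j) \<notin> A" if "f \<in> P" "h (f, j) = w" for f j
    proof
      assume "lab (f, j) \<in> A"
      then have "h (f, j) \<in> hubs h lab A P" unfolding hubs_def using that by (intro imageI) (simp add: active_def)
      then show False using that e2(2) by (simp add: w_def)
    qed
    show "lab (e1, i1) \<notin> A" "lab (e2, i2) \<notin> A" "lab (e3, i3) \<notin> A"
      using *[OF e(1,3)] *[OF e2(1) w_def[symmetric]] *[OF e(2,4)] by simp_all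
    show "lab (e2, \<not> i2) \<notin> A" using e2(1,4) by (simp add: active_def)
  qed
  define P' where "P' = P - {e2, e3}"
  define h' where "h' = h((e1, i1) := h (e3, \<not> i3))"
  \<comment> \<open>The moved half-edge of \<open>e1\<close> stands for the far half of
    \<open>e3\<close>, so it takes over its class along with its vertex.\<close>
  define lab' where "lab' = lab((e1, i1) := lab (e3, \<not> i3))"
  have dt': "double_tree h' P'" unfolding h'_def P'_def by (rule double_tree_reduce[OF P(2) star d])
  \<comment> \<open>The moved half-edge arrives at a vertex where its new class was present before,
    so no hub is new.\<close>
  have hb: "hubs h' lab' B P' \<subseteq> hubs h lab B P" for B
  proof
    fix v assume "v \<in> hubs h' lab' B P'"
    then obtain f j where f: "f \<in> P'" "lab' (f, j) \<in> B" "v = h' (f, j)" by (auto simp: hubs_def active_def)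
    show "v \<in> hubs h lab B P"
    proof (cases "(f, j) = (e1, i1)")
      case True
      then have "(e3, \<not> i3) \<in> active lab B P" "v = h (e3, \<not> i3)"
        using f e by (auto simp: h'_def lab'_def active_def)
      then show ?thesis by (auto simp: hubs_def)
    next
      case False
      then have "(f, j) \<in> active lab B P" "v = h (f, j)"
        using f by (auto simp: h'_def lab'_def active_def P'_def)
      then show ?thesis by (auto simp: hubs_def)
    qed
  qed
  have pc': "pieces h' lab' A ({P'} \<union> (PP - {P}))"
  proof (rule pieces_replace[OF pc P(1)])
    show "(\<Sum>Q \<in> {P'}. card (hubs h' lab' B Q) - 1) \<le> card (hubs h lab B P) - 1" for B
      using card_mono[OF _ hb[of B]] fP by (simp add: diff_le_mono)
  qed (use e dt' in \<open>auto simp: h'_def lab'_def P'_def\<close>)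
  have sz: "size_of ({P'} \<union> (PP - {P})) < size_of PP"
  proof (rule size_of_replace[OF pc P(1)])
    have "card P' < card P" unfolding P'_def using fP e by (intro psubset_card_mono) auto
    then show "(\<Sum>Q \<in> {P'}. 2 * card Q - 1) < 2 * card P - 1" by simp
  qed simp
  have bal: "balanceable h lab A PP t u Z"
    if Z: "Z \<inter> \<Union>PP = {}" and b: "balanceable h' lab' A ({P'} \<union> (PP - {P})) t u Z" for t u Z
  proof -
    obtain col where col: "\<And>R s. R \<in> {P'} \<union> (PP - {P}) \<Longrightarrow> sparse 1 h' {e \<in> R. col e = s}"
      "\<forall>c \<in> A. \<bar>half_sum lab' col (\<Union>({P'} \<union> (PP - {P}))) c + arc_sum t u col Z (Some c)\<bar> \<le> 6"
      "\<forall>c. c \<notin> A \<longrightarrow> \<bar>arc_sum t u col Z (Some c)\<bar> \<le> 1"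
      using b unfolding balanceable_def by blast
    \<comment> \<open>Subdivision gives both halves the colour of the new edge; in the other tree
      \<open>w\<close> becomes a leaf, attached by \<open>e2\<close>.\<close>
    define col' where "col' = col(e2 := \<not> col e1, e3 := col e1)"
    have arc: "arc_sum t u col' Z c = arc_sum t u col Z c" for c
      using Z P(1) e e2(1) by (intro arc_sum_cong) (auto simp: col'_def)
    define E where "E = \<Union>PP - {e1, e2, e3}"
    have fE: "finite E" using pD(1,6) by (auto simp: E_def)
    have e_out: "f \<notin> {e1, e2, e3}" if "f \<in> R" "R \<in> PP - {P}" for f R
      using pD(8)[of R P] that P(1) e e2(1) by auto
    have E1: "\<Union>PP = insert e1 (insert e2 (insert e3 E))" using P(1) e e2(1) by (auto simp: E_def)
    have E2: "\<Union>({P'} \<union> (PP - {P})) = insert e1 E"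
      using P(1) e e2(1) d e_out unfolding E_def P'_def by blast
    have out: "e1 \<notin> E" "e2 \<notin> E" "e3 \<notin> E" by (auto simp: E_def)
    have hs: "half_sum lab col' (\<Union>PP) c = half_sum lab' col (\<Union>({P'} \<union> (PP - {P}))) c" if c: "c \<in> A" for c
    proof -
      have "half_sum lab col' E c = half_sum lab' col E c"
        using out by (intro half_sum_cong) (auto simp: col'_def lab'_def)
      moreover have "lab (e1, i1) \<noteq> c" "lab (e2, i2) \<noteq> c" "lab (e3, i3) \<noteq> c" "lab (e2, \<not> i2) \<noteq> c"
        using inact c by auto
      ultimately show ?thesis unfolding E1 E2
        using fE out d by (simp add: half_sum_insert[of _ e1 _ _ _ i1] half_sum_insert[of _ e2 _ _ _ i2]
            half_sum_insert[of _ e3 _ _ _ i3])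
          (simp add: lab'_def col'_def algebra_simps)
    qed
    have "sparse 1 h {e \<in> R. col' e = s}" if R: "R \<in> PP" for R s
    proof (cases "R = P")
      case False
      then have RR: "R \<in> PP - {P}" using R by auto
      have "{e \<in> R. col' e = s} = {e \<in> R. col e = s}" using e_out[OF _ RR] by (auto simp: col'_def)
      moreover have "sparse 1 h {e \<in> R. col e = s} \<longleftrightarrow> sparse 1 h' {e \<in> R. col e = s}"
        using e_out[OF _ RR] by (intro sparse_cong) (auto simp: h'_def)
      ultimately show ?thesis using col(1)[of R s] RR by auto
    next
      case True
      let ?F = "{e \<in> P'. col e = s}"
      have fF: "finite ?F" using fP by (auto simp: P'_def)
      have F: "sparse 1 h' ?F" using col(1)[of P' s] by simp
      have sub: "?F - {e1} \<subseteq> P - {e1, e2, e3}" by (auto simp: P'_def)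
      have wF: "w \<notin> vset h (?F - {e1})" using wout vset_mono[OF sub, of h] by blast
      show ?thesis
      proof (cases "col e1 = s")
        case c1: True
        have "sparse 1 h (insert e3 ?F)"
          using F c1 e d nw wF unfolding h'_def
          by (intro forest_subdivide[OF fF, of h e1 i1 e3 i3 w]) (auto simp: P'_def)
        moreover have "{e \<in> P. col' e = s} = insert e3 ?F"
          using c1 e e2(1) d by (auto simp: col'_def P'_def)
        ultimately show ?thesis unfolding True by simp
      next
        case c1: False
        have F1: "?F - {e1} = ?F" using c1 by auto
        have "sparse 1 h ?F \<longleftrightarrow> sparse 1 h' ?F" using c1 by (intro sparse_cong) (auto simp: h'_def)
        then have "sparse 1 h (insert e2 ?F)"
          using F wF nw(2) unfolding F1
          by (intro forest_insert_leaf[OF fF, of h e2 i2]) (auto simp: P'_def w_def)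
        moreover have "{e \<in> P. col' e = s} = insert e2 ?F"
          using c1 e e2(1) d by (auto simp: col'_def P'_def)
        ultimately show ?thesis unfolding True by simp
      qed
    qed
    moreover have "\<forall>c \<in> A. \<bar>half_sum lab col' (\<Union>PP) c + arc_sum t u col' Z (Some c)\<bar> \<le> 6"
      using col(2) hs arc by simp
    moreover have "\<forall>c. c \<notin> A \<longrightarrow> \<bar>arc_sum t u col' Z (Some c)\<bar> \<le> 1" using col(3) arc by simp
    ultimately show ?thesis unfolding balanceable_def by blast
  qed
  show ?thesis by (rule that[OF pc' _ sz bal]) (auto simp: P'_def)
qed

text \<open>The two parallel edges must get opposite colours, which leaves one binary choice. All
  active half-edges lie at a single vertex \<open>x\<close>, so the choice adds a sign to the class
  of \<open>e\<close> at \<open>x\<close> and the opposite sign to that of \<open>f\<close>: this is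
  an arc, to be oriented later.\<close>

lemma pieces_arc:
  fixes h :: "'e \<times> bool \<Rightarrow> 'v" and lab :: "'e \<times> bool \<Rightarrow> 'c"
  assumes pc: "pieces h lab A PP" and P: "P \<in> PP"
    and two: "card (vset h P) = 2" "card (hubs h lab A P) \<le> 1"
    and Z: "finite Z" "Z \<inter> \<Union>PP = {}"
  obtains e t' u' where "e \<in> P" "pieces h lab A (PP - {P})" "size_of (PP - {P}) < size_of PP"
    "balanceable h lab A (PP - {P}) t' u' (insert e Z) \<Longrightarrow> balanceable h lab A PP t u Z"
proof -
  note pD = piecesD[OF pc]
  have fP: "finite P" by (rule pD(6)[OF P])
  have dt: "sparse 2 h P" "card P = 2" using pD(3)[OF P] two by (auto simp: double_tree_def)
  obtain e f where ef: "P = {e, f}" "e \<noteq> f" using dt(2) by (meson card_2_iff)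
  have ePfP: "e \<in> P" "f \<in> P" using ef(1) by simp_all
  \<comment> \<open>If there is no hub, any vertex of \<open>P\<close> serves as
    \<open>x\<close>.\<close>
  obtain x where x: "hubs h lab A P \<subseteq> {x}" "x \<in> vset h P"
  proof (cases "hubs h lab A P = {}")
    case True
    then show ?thesis using that[of "h (e, True)"] in_vsetI[OF ePfP(1), of h True] by simp
  next
    case False
    then have "card (hubs h lab A P) \<noteq> 0" using fP by simp
    then have "card (hubs h lab A P) = 1" using two(2) by linarith
    then obtain y where "hubs h lab A P = {y}" by (rule card_1_singletonE)
    then show ?thesis using that[of y] hubs_subset_vset[of h lab A P] by simp
  qed
  have end_at: "\<exists>i. h (g, i) = x \<and> h (g, \<not> i) \<noteq> x" if g: "g \<in> P" for g
  proof -
    have "vset h {g} = {h (g, True), h (g, False)}" using vset_insert[of h g "{}" True] by simp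
    then have "card (vset h {g}) = 2" using sparse_loopless[OF dt(1) g, of True] by simp
    then have "vset h {g} = vset h P"
      using two(1) fP g by (intro card_subset_eq vset_mono) auto
    then have "x \<in> vset h {g}" using x(2) by simp
    then obtain i where "h (g, i) = x" by (auto simp: vset_def)
    then show ?thesis using sparse_loopless[OF dt(1) g, of i] by (intro exI[of _ i]) simp
  qed
  obtain i where i: "h (e, i) = x" "h (e, \<not> i) \<noteq> x" using end_at[OF ePfP(1)] by blast
  obtain j where j: "h (f, j) = x" "h (f, \<not> j) \<noteq> x" using end_at[OF ePfP(2)] by blast
  have inact: "lab (e, \<not> i) \<notin> A" "lab (f, \<not> j) \<notin> A"
    using x(1) i(2) j(2) ePfP by (auto simp: hubs_def active_def)
  \<comment> \<open>\<open>None\<close> is a dummy end for classes that are not under control, so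
    new arcs leave their sums alone. The arc is named \<open>e\<close>, which is not yet in use
    because \<open>Z\<close> is disjoint from the pieces.\<close>
  define t' where "t' = t(e := if lab (e, i) \<in> A then Some (lab (e, i)) else None)"
  define u' where "u' = u(e := if lab (f, j) \<in> A then Some (lab (f, j)) else None)"
  have pc': "pieces h lab A (PP - {P})"
    using pieces_replace[OF pc P, of "{}" h lab] by simp
  have "card P > 0" using dt(2) by simp
  then have sz: "size_of (PP - {P}) < size_of PP"
    using size_of_replace[OF pc P, of "{}"] by simp
  have eZ: "e \<notin> Z" "f \<notin> Z" using Z(2) P ef by auto
  have "balanceable h lab A PP t u Z" if b: "balanceable h lab A (PP - {P}) t' u' (insert e Z)"
  proof -
    obtain col where col: "\<And>R s. R \<in> PP - {P} \<Longrightarrow> sparse 1 h {e \<in> R. col e = s}"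
      "\<forall>c \<in> A. \<bar>half_sum lab col (\<Union>(PP - {P})) c + arc_sum t' u' col (insert e Z) (Some c)\<bar> \<le> 6"
      "\<forall>c. c \<notin> A \<longrightarrow> \<bar>arc_sum t' u' col (insert e Z) (Some c)\<bar> \<le> 1"
      using b unfolding balanceable_def by blast
    define col' where "col' = col(f := \<not> col e)"
    define E where "E = \<Union>(PP - {P})"
    have "g \<notin> E" if "g \<in> P" for g
    proof
      assume "g \<in> E"
      then obtain R where "R \<in> PP" "R \<noteq> P" "g \<in> R" by (auto simp: E_def)
      then show False using pD(8)[of R P] P that by blast
    qed
    then have out: "e \<notin> E" "f \<notin> E" using ef(1) by simp_all
    have fE: "finite E" using pD(1,6) by (auto simp: E_def)
    have E1: "\<Union>PP = insert e (insert f E)" using P ef by (auto simp: E_def)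
    have arcZ: "arc_sum t' u' col Z c = arc_sum t u col' Z c" for c
      using eZ by (intro arc_sum_cong) (auto simp: t'_def u'_def col'_def)
    have arc: "arc_sum t' u' col (insert e Z) c = sg (col e) * (of_bool (t' e = c) - of_bool (u' e = c)) + arc_sum t u col' Z c" for c
      using Z(1) eZ by (simp add: arc_sum_insert arcZ)
    have hs: "half_sum lab col' (\<Union>PP) c + arc_sum t u col' Z (Some c) =
        half_sum lab col E c + arc_sum t' u' col (insert e Z) (Some c)" if c: "c \<in> A" for c
    proof -
      have "half_sum lab col' E c = half_sum lab col E c"
        using out by (intro half_sum_cong) (auto simp: col'_def)
      moreover have "lab (e, \<not> i) \<noteq> c" "lab (f, \<not> j) \<noteq> c" using inact c by auto
      moreover have "(t' e = Some c) = (lab (e, i) = c)" "(u' e = Some c) = (lab (f, j) = c)"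
        using c by (auto simp: t'_def u'_def)
      ultimately show ?thesis unfolding E1 arc
        using fE out ef(2) by (simp add: half_sum_insert[of _ e _ _ _ i] half_sum_insert[of _ f _ _ _ j])
          (simp add: col'_def algebra_simps)
    qed
    have "sparse 1 h {e \<in> R. col' e = s}" if R: "R \<in> PP" for R s
    proof (cases "R = P")
      case False
      then have "f \<notin> R" using out R by (auto simp: E_def)
      then have "{e \<in> R. col' e = s} = {e \<in> R. col e = s}" by (auto simp: col'_def)
      then show ?thesis using col(1)[of R s] R False by auto
    next
      case True
      have "sparse 1 h {g}" if g: "g \<in> P" for g
      proof -
        have "sparse 1 h {}" by (auto simp: sparse_def)
        then show ?thesis using sparse_loopless[OF dt(1) g, of True]
          by (intro forest_insert_leaf[of "{}" h g True]) auto
      qed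
      moreover have "{e' \<in> P. col' e' = s} = (if col e = s then {e} else {f})"
        using ef(2) unfolding ef(1) by (cases "col e"; cases s) (auto simp: col'_def)
      ultimately show ?thesis using ef(1) unfolding True by simp
    qed
    moreover have "\<forall>c \<in> A. \<bar>half_sum lab col' (\<Union>PP) c + arc_sum t u col' Z (Some c)\<bar> \<le> 6"
      using col(2) hs by (simp add: E_def)
    moreover have "\<bar>arc_sum t u col' Z (Some c)\<bar> \<le> 1" if c: "c \<notin> A" for c
    proof -
      have "t' e \<noteq> Some c" "u' e \<noteq> Some c" using c by (auto simp: t'_def u'_def)
      then have "arc_sum t' u' col (insert e Z) (Some c) = arc_sum t u col' Z (Some c)"
        using arc[of "Some c"] by simp
      then show ?thesis using col(3) c by metis
    qed
    ultimately show ?thesis unfolding balanceable_def by blast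
  qed
  then show ?thesis using ef(1) by (intro that[OF _ pc' sz]) auto
qed

section \<open>Counting half-edges by classes\<close>

lemma card_active_eq_sum:
  assumes "finite A" "finite E"
  shows "card (active lab A E) = (\<Sum>c \<in> A. card {q \<in> E \<times> UNIV. lab q = c})"
proof -
  have "active lab A E = (\<Union>c \<in> A. {q \<in> E \<times> UNIV. lab q = c})" by (auto simp: active_def)
  then show ?thesis using assms by (simp only:) (subst card_UN_disjoint, auto)
qed

lemma abs_half_sum_le:
  assumes "finite E"
  shows "\<bar>half_sum lab col E c\<bar> \<le> int (card {q \<in> E \<times> UNIV. lab q = c})"
proof -
  have "\<bar>half_sum lab col E c\<bar> \<le> (\<Sum>q \<in> E \<times> UNIV. \<bar>of_bool (lab q = c) * sg (col (fst q))\<bar>)"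
    unfolding half_sum_def by (rule sum_abs)
  also have "\<dots> = (\<Sum>q \<in> E \<times> UNIV. of_bool (lab q = c))"
    by (intro sum.cong) (auto simp: abs_mult)
  also have "\<dots> = int (card {q \<in> E \<times> UNIV. lab q = c})"
    using assms by (simp add: of_bool_def sum.If_cases Int_def)
  finally show ?thesis .
qed

text \<open>If every class had 6 half-edges, at least \<open>6 * card A\<close> would be active. But
  a piece has at most 6 for each hub beyond its first, and the hyperforest condition allows at most
  \<open>card A - 1\<close> such hubs in total.\<close>

lemma exists_small_class:
  assumes pc: "pieces h lab A PP" and ne: "PP \<noteq> {}"
    and no_split: "\<And>P Q. P \<in> PP \<Longrightarrow> Q \<subseteq> P \<Longrightarrow> Q \<noteq> {} \<Longrightarrow> Q \<noteq> P \<Longrightarrow> card Q + 2 \<noteq> 2 * card (vset h Q)"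
    and no_arc: "\<And>P. P \<in> PP \<Longrightarrow> card (vset h P) = 2 \<Longrightarrow> 2 \<le> card (hubs h lab A P)"
    and no_reduce: "\<And>P e i. P \<in> PP \<Longrightarrow> prime_double_tree h P \<Longrightarrow> e \<in> P \<Longrightarrow>
      h (e, i) \<notin> hubs h lab A P \<Longrightarrow> deg h P (h (e, i)) = 3 \<Longrightarrow> (e, \<not> i) \<in> active lab A P"
  shows "\<exists>c \<in> A. card {q \<in> \<Union>PP \<times> UNIV. lab q = c} \<le> 5"
proof (rule ccontr)
  assume no: "\<not> ?thesis"
  have big: "6 \<le> card {q \<in> \<Union>PP \<times> UNIV. lab q = c}" if "c \<in> A" for c
  proof -
    have "\<not> card {q \<in> \<Union>PP \<times> UNIV. lab q = c} \<le> 5" using no that by blast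
    then show ?thesis by linarith
  qed
  note pD = piecesD[OF pc]
  have each: "hubs h lab A P \<noteq> {} \<and> card (active lab A P) \<le> 6 * (card (hubs h lab A P) - 1)" if P: "P \<in> PP" for P
  proof (cases "card (vset h P) = 2")
    case True
    then have "card P = 2" using pD(3)[OF P] by (auto simp: double_tree_def)
    \<comment> \<open>A piece on 2 vertices has only 4 half-edges, fewer than the 6 that two hubs
      allow.\<close>
    have "card (active lab A P) \<le> card (P \<times> (UNIV :: bool set))"
      using pD(6)[OF P] by (intro card_mono) (auto simp: active_def)
    also have "\<dots> = 4" using \<open>card P = 2\<close> by (simp add: card_cartesian_product)
    finally show ?thesis using no_arc[OF P True] by auto
  next
    case False
    have "card P + 2 = 2 * card (vset h P)" "card P \<noteq> 0"
      using pD(3)[OF P] by (auto simp: double_tree_def)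
    then have "3 \<le> card (vset h P)" using False by linarith
    then have "prime_double_tree h P"
      using pD(3)[OF P] no_split[OF P] by (auto simp: prime_double_tree_def)
    then show ?thesis using card_active_le[of h P lab A] no_reduce[OF P] by blast
  qed
  obtain P where P: "P \<in> PP" using ne by auto
  have A: "A \<noteq> {}" using each[OF P] by (auto simp: hubs_def active_def)
  have fE: "finite (\<Union>PP)" using pD(1,6) by auto
  have "6 * card A = (\<Sum>c \<in> A. 6)" by simp
  also have "\<dots> \<le> (\<Sum>c \<in> A. card {q \<in> \<Union>PP \<times> UNIV. lab q = c})" by (rule sum_mono) (rule big)
  also have "\<dots> = card (active lab A (\<Union>PP))" using card_active_eq_sum[OF pD(4) fE, of lab] by simp
  also have "active lab A (\<Union>PP) = (\<Union>P \<in> PP. active lab A P)" by (auto simp: active_def)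
  also have "card \<dots> \<le> (\<Sum>P \<in> PP. card (active lab A P))" by (rule card_UN_le[OF pD(1)])
  also have "\<dots> \<le> (\<Sum>P \<in> PP. 6 * (card (hubs h lab A P) - 1))" by (rule sum_mono) (use each in auto)
  also have "\<dots> = 6 * (\<Sum>P \<in> PP. card (hubs h lab A P) - 1)" by (simp add: sum_distrib_left)
  finally show False using pD(5)[OF subset_refl A] by linarith
qed

text \<open>Each move lowers the size of the pieces or the number of controlled classes, and by
  \<open>exists_small_class\<close> some move applies as long as pieces remain. The arcs vary in the
  induction because removing a piece adds one.\<close>

lemma balanceable_pieces:
  fixes h :: "'e \<times> bool \<Rightarrow> 'v" and lab :: "'e \<times> bool \<Rightarrow> 'c"
  assumes "pieces h lab A PP" "finite Z" "Z \<inter> \<Union>PP = {}"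
  shows "balanceable h lab A PP t u Z"
  using assms
proof (induction "size_of PP + card A" arbitrary: h lab A PP t u Z rule: less_induct)
  case less
  note pc = less.prems(1) and Z = less.prems(2,3)
  note pD = piecesD[OF pc]
  consider (base) "PP = {}"
    | (split) P Q where "P \<in> PP" "Q \<subseteq> P" "Q \<noteq> {}" "Q \<noteq> P" "card Q + 2 = 2 * card (vset h Q)"
    | (arc) P where "P \<in> PP" "card (vset h P) = 2" "card (hubs h lab A P) \<le> 1"
    | (reduce) P e i where "P \<in> PP" "prime_double_tree h P" "e \<in> P"
      "h (e, i) \<notin> hubs h lab A P" "deg h P (h (e, i)) = 3" "(e, \<not> i) \<notin> active lab A P"
    | (drop) c where "c \<in> A" "card {q \<in> \<Union>PP \<times> UNIV. lab q = c} \<le> 5"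
  proof (cases "PP = {}")
    case False
    show ?thesis
    proof (rule ccontr)
      assume no: "\<not> thesis"
      have "\<exists>c \<in> A. card {q \<in> \<Union>PP \<times> UNIV. lab q = c} \<le> 5"
      proof (rule exists_small_class[OF pc False])
        show "card Q + 2 \<noteq> 2 * card (vset h Q)" if "P \<in> PP" "Q \<subseteq> P" "Q \<noteq> {}" "Q \<noteq> P" for P Q
          using no split that by blast
        show "2 \<le> card (hubs h lab A P)" if "P \<in> PP" "card (vset h P) = 2" for P
          using no arc[OF that] by fastforce
        show "(e, \<not> i) \<in> active lab A P" if "P \<in> PP" "prime_double_tree h P" "e \<in> P"
          "h (e, i) \<notin> hubs h lab A P" "deg h P (h (e, i)) = 3" for P e i
          using no reduce that by blast
      qed
      then show False using no drop by blast
    qed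
  qed
  then show ?case
  proof cases
    case base
    \<comment> \<open>Without pieces only the recorded sign choices remain, and a balanced
      orientation settles them all at once.\<close>
    obtain col where col: "\<And>d. \<bar>arc_sum t u col Z d\<bar> \<le> 1" using balanced_orientation[OF Z(1), of t u] by blast
    moreover have "\<bar>arc_sum t u col Z d\<bar> \<le> 6" for d using col[of d] by linarith
    moreover have "half_sum lab col (\<Union>PP) c = 0" for c using base by (simp add: half_sum_def)
    ultimately show ?thesis unfolding balanceable_def using base
      by (intro exI[of _ col]) auto
  next
    case split
    obtain h' :: "'e \<times> bool \<Rightarrow> 'v" where h': "pieces h' lab A ({Q, P - Q} \<union> (PP - {P}))"
      "size_of ({Q, P - Q} \<union> (PP - {P})) < size_of PP"
      "\<And>t u Z. balanceable h' lab A ({Q, P - Q} \<union> (PP - {P})) t u Z \<Longrightarrow> balanceable h lab A PP t u Z"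
      using pieces_split[OF pc split] by metis
    have "Z \<inter> \<Union>({Q, P - Q} \<union> (PP - {P})) = {}" using Z(2) split(1,2) by blast
    then show ?thesis using h' Z by (intro h'(3) less.hyps) auto
  next
    case arc
    obtain e t' u' where e: "e \<in> P" "pieces h lab A (PP - {P})" "size_of (PP - {P}) < size_of PP"
      "balanceable h lab A (PP - {P}) t' u' (insert e Z) \<Longrightarrow> balanceable h lab A PP t u Z"
      using pieces_arc[OF pc arc Z] by metis
    have "e \<notin> \<Union>(PP - {P})" using pD(8) arc(1) e(1) by blast
    then have "insert e Z \<inter> \<Union>(PP - {P}) = {}" using Z(2) by blast
    then show ?thesis using e Z by (intro e(4) less.hyps) auto
  next
    case reduce
    obtain h' :: "'e \<times> bool \<Rightarrow> 'v" and lab' :: "'e \<times> bool \<Rightarrow> 'c" and P' where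
      r: "pieces h' lab' A ({P'} \<union> (PP - {P}))" "P' \<subseteq> P"
      "size_of ({P'} \<union> (PP - {P})) < size_of PP"
      "\<And>t u Z. Z \<inter> \<Union>PP = {} \<Longrightarrow> balanceable h' lab' A ({P'} \<union> (PP - {P})) t u Z \<Longrightarrow>
        balanceable h lab A PP t u Z"
      using pieces_reduce[OF pc reduce] by metis
    have "Z \<inter> \<Union>({P'} \<union> (PP - {P})) = {}" using Z(2) reduce(1) r(2) by blast
    then show ?thesis using r Z by (intro r(4) less.hyps) auto
  next
    case drop
    \<comment> \<open>This case determines the constant 6: at most 5 from the remaining half-edges
      of \<open>c\<close> and at most 1 from the arcs present now, since later arcs avoid
      \<open>c\<close>.\<close>
    have "pieces h lab (A - {c}) PP" using pc unfolding pieces_def by blast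
    moreover have "card (A - {c}) < card A" using pD(4) drop(1) by (rule card_Diff1_less)
    ultimately have "balanceable h lab (A - {c}) PP t u Z" using Z by (intro less.hyps) auto
    then obtain col where col: "\<forall>P \<in> PP. \<forall>s. sparse 1 h {e \<in> P. col e = s}"
      "\<forall>c' \<in> A - {c}. \<bar>half_sum lab col (\<Union>PP) c' + arc_sum t u col Z (Some c')\<bar> \<le> 6"
      "\<forall>c'. c' \<notin> A - {c} \<longrightarrow> \<bar>arc_sum t u col Z (Some c')\<bar> \<le> 1"
      unfolding balanceable_def by blast
    have "\<bar>half_sum lab col (\<Union>PP) c\<bar> \<le> int (card {q \<in> \<Union>PP \<times> UNIV. lab q = c})"
      using pD(1,6) by (intro abs_half_sum_le) auto
    then have "\<bar>half_sum lab col (\<Union>PP) c\<bar> \<le> 5" using drop(2) by linarith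
    moreover have "\<bar>arc_sum t u col Z (Some c)\<bar> \<le> 1" using col(3) by auto
    ultimately have "\<bar>half_sum lab col (\<Union>PP) c + arc_sum t u col Z (Some c)\<bar> \<le> 6" by linarith
    then show ?thesis using col unfolding balanceable_def by (intro exI[of _ col]) auto
  qed
qed

section \<open>From one piece back to two trees\<close>

text \<open>\<open>V\<close> is explicit because the tree on a single vertex has no edges and so
  covers nothing. The edge count makes the acyclic set spanning.\<close>

definition tree_set :: "'v set \<Rightarrow> ('e \<times> bool \<Rightarrow> 'v) \<Rightarrow> 'e set \<Rightarrow> bool" where
  "tree_set V h F \<longleftrightarrow> finite F \<and> sparse 1 h F \<and> card F + 1 = card V \<and> vset h F \<subseteq> V"

lemma deg_Un_disjoint:
  assumes "finite F" "finite F'" "F \<inter> F' = {}"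
  shows "deg h (F \<union> F') v = deg h F v + deg h F' v"
proof -
  have "{q \<in> (F \<union> F') \<times> UNIV. h q = v} = {q \<in> F \<times> UNIV. h q = v} \<union> {q \<in> F' \<times> UNIV. h q = v}" by auto
  then have "deg h (F \<union> F') v = card ({q \<in> F \<times> UNIV. h q = v} \<union> {q \<in> F' \<times> UNIV. h q = v})"
    unfolding deg_def by (rule arg_cong)
  also have "\<dots> = deg h F v + deg h F' v"
    unfolding deg_def using assms by (intro card_Un_disjoint) auto
  finally show ?thesis .
qed

lemma half_sum_eq_deg_diff:
  assumes "finite P"
  shows "half_sum h col P v = int (deg h {e \<in> P. col e} v) - int (deg h {e \<in> P. \<not> col e} v)"
proof -
  have split: "half_sum h col P v = half_sum h col {e \<in> P. col e} v + half_sum h col {e \<in> P. \<not> col e} v"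
  proof -
    have "P \<times> (UNIV :: bool set) = {e \<in> P. col e} \<times> UNIV \<union> {e \<in> P. \<not> col e} \<times> UNIV" by blast
    then have "half_sum h col P v =
        (\<Sum>q \<in> {e \<in> P. col e} \<times> UNIV \<union> {e \<in> P. \<not> col e} \<times> UNIV. of_bool (h q = v) * sg (col (fst q)))"
      unfolding half_sum_def by (rule arg_cong)
    also have "\<dots> = half_sum h col {e \<in> P. col e} v + half_sum h col {e \<in> P. \<not> col e} v"
      unfolding half_sum_def using assms by (intro sum.union_disjoint) auto
    finally show ?thesis .
  qed
  have const: "half_sum h col Q v = sg s * int (deg h Q v)" if "finite Q" "\<And>e. e \<in> Q \<Longrightarrow> col e = s" for Q s
  proof -
    have "half_sum h col Q v = (\<Sum>q \<in> Q \<times> UNIV. sg s * of_bool (h q = v))"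
      unfolding half_sum_def
    proof (rule sum.cong[OF refl])
      fix q :: "'a \<times> bool" assume "q \<in> Q \<times> UNIV"
      then have "col (fst q) = s" by (intro that(2)) (simp add: mem_Times_iff)
      then show "of_bool (h q = v) * sg (col (fst q)) = sg s * of_bool (h q = v)" by simp
    qed
    also have "\<dots> = sg s * (\<Sum>q \<in> Q \<times> UNIV. of_bool (h q = v))" by (rule sum_distrib_left[symmetric])
    also have "(\<Sum>q \<in> Q \<times> UNIV. of_bool (h q = v)) = int (deg h Q v)"
      unfolding deg_def using that(1) by (simp add: of_bool_def sum.If_cases Int_def)
    finally show ?thesis .
  qed
  have "half_sum h col {e \<in> P. col e} v = sg True * int (deg h {e \<in> P. col e} v)"
    using assms by (intro const) auto
  moreover have "half_sum h col {e \<in> P. \<not> col e} v = sg False * int (deg h {e \<in> P. \<not> col e} v)"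
    using assms by (intro const) auto
  ultimately show ?thesis unfolding split by (simp add: sg_def)
qed

text \<open>A nonempty set meets each acyclic part in fewer edges than it covers vertices, and the
  two bounds add up.\<close>

lemma double_tree_of_tree_sets:
  assumes F: "tree_set V h F1" "tree_set V h F2" "F1 \<inter> F2 = {}" and V: "finite V" "card V \<noteq> 1"
  shows "double_tree h (F1 \<union> F2)" "vset h (F1 \<union> F2) = V"
proof -
  let ?P = "F1 \<union> F2"
  have f: "finite F1" "finite F2" "sparse 1 h F1" "sparse 1 h F2" "card F1 + 1 = card V"
    "card F2 + 1 = card V" "vset h F1 \<subseteq> V" "vset h F2 \<subseteq> V"
    using F by (auto simp: tree_set_def)
  have part: "card (Q \<inter> F) + 1 \<le> card (vset h Q)" if "sparse 1 h F" "finite Q" "Q \<noteq> {}" for Q F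
  proof (cases "Q \<inter> F = {}")
    case True
    have "card (vset h Q) \<noteq> 0" using that by simp
    then show ?thesis using True by simp
  next
    case False
    have "card (Q \<inter> F) + 1 \<le> 1 * card (vset h (Q \<inter> F))" by (rule sparseD[OF that(1) _ False]) simp
    also have "1 * card (vset h (Q \<inter> F)) \<le> card (vset h Q)"
      using that(2) vset_mono[of "Q \<inter> F" Q h] by (simp add: card_mono)
    finally show ?thesis .
  qed
  have sp: "sparse 2 h ?P"
    unfolding sparse_def
  proof (intro allI impI)
    fix Q assume Q: "Q \<subseteq> ?P" "Q \<noteq> {}"
    have fQ: "finite Q" using Q(1) f(1,2) by (meson finite_UnI finite_subset)
    have "Q = (Q \<inter> F1) \<union> (Q \<inter> F2)" using Q(1) by auto
    then have "card Q = card (Q \<inter> F1) + card (Q \<inter> F2)"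
      using fQ F(3) card_Un_disjoint[of "Q \<inter> F1" "Q \<inter> F2"] by auto
    then show "card Q + 2 \<le> 2 * card (vset h Q)"
      using part[OF f(3) fQ Q(2)] part[OF f(4) fQ Q(2)] by linarith
  qed
  have c: "card ?P + 2 = 2 * card V" using card_Un_disjoint[OF f(1,2) F(3)] f(5,6) by linarith
  then have "card ?P \<noteq> 0" using V(2) by linarith
  then have ne: "?P \<noteq> {}" by (metis card.empty)
  have sub: "vset h ?P \<subseteq> V" using f(7,8) by (simp add: vset_Un)
  have "card ?P + 2 \<le> 2 * card (vset h ?P)" by (rule sparseD[OF sp _ ne]) simp
  then have "card V \<le> card (vset h ?P)" using c by linarith
  then show v: "vset h ?P = V" using V(1) sub by (simp add: card_seteq)
  show "double_tree h ?P" unfolding double_tree_def v using f(1,2) ne sp c by simp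
qed

text \<open>The moves start from a single piece, with every vertex as its own class and no arcs; the
  two colours then yield the new trees.\<close>

lemma balance_two_tree_sets:
  assumes F: "tree_set V h F1" "tree_set V h F2" "F1 \<inter> F2 = {}" and V: "finite V"
  obtains F1' F2' where "tree_set V h F1'" "tree_set V h F2'" "F1' \<inter> F2' = {}"
    "F1' \<union> F2' = F1 \<union> F2" "\<And>v. \<bar>int (deg h F1' v) - int (deg h F2' v)\<bar> \<le> 6"
proof (cases "card V = 1")
  case True
  \<comment> \<open>The union is empty here, which \<open>double_tree\<close> excludes.\<close>
  then have "F1 = {}" "F2 = {}" using F by (auto simp: tree_set_def)
  then show ?thesis using F that[of "{}" "{}"] by simp
next
  case False
  define P where "P = F1 \<union> F2"
  have dt: "double_tree h P" "vset h P = V"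
    unfolding P_def using double_tree_of_tree_sets[OF F V False] by auto
  have fP: "finite P" and cP: "card P + 2 = 2 * card V" using dt by (auto simp: double_tree_def)
  have "pieces h h V {P}"
    unfolding pieces_def
  proof (intro conjI allI impI)
    fix B assume B: "B \<subseteq> V" "B \<noteq> {}"
    have fB: "finite B" using B(1) V by (rule finite_subset)
    have "card (hubs h h B P) \<le> card B"
      using fB by (intro card_mono) (auto simp: hubs_def active_def)
    moreover have "card B \<noteq> 0" using B(2) fB by simp
    ultimately show "(\<Sum>P \<in> {P}. card (hubs h h B P) - 1) + 1 \<le> card B" by simp
  qed (use dt V in auto)
  then have "balanceable h h V {P} (\<lambda>_. None) (\<lambda>_. None) {}" by (rule balanceable_pieces) auto
  then obtain col where col': "\<forall>P \<in> {P}. \<forall>s. sparse 1 h {e \<in> P. col e = s}"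
    "\<forall>v \<in> V. \<bar>half_sum h col (\<Union>{P}) v + arc_sum (\<lambda>_. None) (\<lambda>_. None) col {} (Some v)\<bar> \<le> 6"
    unfolding balanceable_def by blast
  have col: "\<And>s. sparse 1 h {e \<in> P. col e = s}" "\<And>v. v \<in> V \<Longrightarrow> \<bar>half_sum h col P v\<bar> \<le> 6"
    using col' by (simp_all add: arc_sum_def)
  let ?F1 = "{e \<in> P. col e}" and ?F2 = "{e \<in> P. \<not> col e}"
  have sp: "sparse 1 h ?F1" "sparse 1 h ?F2" using col(1)[of True] col(1)[of False] by simp_all
  have "card V \<noteq> 0" using cP by linarith
  have le: "card F + 1 \<le> card V" if "F \<subseteq> P" "sparse 1 h F" for F
  proof (cases "F = {}")
    case True then show ?thesis using \<open>card V \<noteq> 0\<close> by simp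
  next
    case False
    have "card F + 1 \<le> 1 * card (vset h F)" by (rule sparseD[OF that(2) subset_refl False])
    also have "\<dots> \<le> card V" using vset_mono[OF that(1), of h] V dt(2) by (simp add: card_mono)
    finally show ?thesis .
  qed
  have un: "?F1 \<union> ?F2 = P" and dj: "?F1 \<inter> ?F2 = {}" by auto
  have "card ?F1 + card ?F2 = card P"
    using card_Un_disjoint[of ?F1 ?F2] fP un dj by simp
  \<comment> \<open>Each forest has at most \<open>card V - 1\<close> edges and together they have
    \<open>2 * card V - 2\<close>, so both are spanning trees.\<close>
  then have "card ?F1 + 1 = card V" "card ?F2 + 1 = card V"
    using le[OF _ sp(1)] le[OF _ sp(2)] cP by auto
  then have ts: "tree_set V h ?F1" "tree_set V h ?F2"
    using sp fP dt(2) vset_mono[of ?F1 P h] vset_mono[of ?F2 P h] by (auto simp: tree_set_def)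
  have "\<bar>int (deg h ?F1 v) - int (deg h ?F2 v)\<bar> \<le> 6" for v
  proof (cases "v \<in> V")
    case True
    show ?thesis using col(2)[OF True] unfolding half_sum_eq_deg_diff[OF fP] .
  next
    case False
    have "deg h F v = 0" if "F \<subseteq> P" for F
    proof -
      have "{q \<in> F \<times> UNIV. h q = v} = {}" using that False dt(2) by (auto simp: vset_def)
      then show ?thesis unfolding deg_def by (simp only: card.empty)
    qed
    then have "deg h ?F1 v = 0" "deg h ?F2 v = 0" by simp_all
    then show ?thesis by simp
  qed
  then show ?thesis using un unfolding P_def by (intro that[OF ts dj]) (simp_all add: P_def)
qed

section \<open>Balancing many trees\<close>

definition tree_family :: "'v set \<Rightarrow> ('e \<times> bool \<Rightarrow> 'v) \<Rightarrow> nat set \<Rightarrow> (nat \<Rightarrow> 'e set) \<Rightarrow> bool" where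
  "tree_family V h I F \<longleftrightarrow> (\<forall>i \<in> I. tree_set V h (F i)) \<and>
     (\<forall>i \<in> I. \<forall>j \<in> I. i \<noteq> j \<longrightarrow> F i \<inter> F j = {})"

definition rdeg :: "('e \<times> bool \<Rightarrow> 'v) \<Rightarrow> 'e set \<Rightarrow> 'v \<Rightarrow> real" where
  "rdeg h F v = real (deg h F v)"

text \<open>\<open>S\<close> contains the indices whose trees may change; since the others stay
  fixed, steps on disjoint index sets do not interfere.\<close>

definition rebalance ::
    "'v set \<Rightarrow> ('e \<times> bool \<Rightarrow> 'v) \<Rightarrow> nat set \<Rightarrow> nat set \<Rightarrow> (nat \<Rightarrow> 'e set) \<Rightarrow> (nat \<Rightarrow> 'e set) \<Rightarrow> bool" where
  "rebalance V h I S F F' \<longleftrightarrow> tree_family V h I F' \<and> \<Union>(F' ` I) = \<Union>(F ` I) \<and>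
     (\<forall>l. l \<notin> S \<longrightarrow> F' l = F l)"

lemma rebalanceD:
  assumes "rebalance V h I S F F'"
  shows "tree_family V h I F'" "\<Union>(F' ` I) = \<Union>(F ` I)" "\<And>l. l \<notin> S \<Longrightarrow> F' l = F l"
  using assms by (simp_all add: rebalance_def)

lemma rebalance_trans:
  assumes "rebalance V h I S F F'" "rebalance V h I S' F' F''" "S \<union> S' \<subseteq> S''"
  shows "rebalance V h I S'' F F''"
  unfolding rebalance_def
proof (intro conjI allI impI)
  show "tree_family V h I F''" by (rule rebalanceD(1)[OF assms(2)])
  show "\<Union>(F'' ` I) = \<Union>(F ` I)" using rebalanceD(2)[OF assms(1)] rebalanceD(2)[OF assms(2)] by simp
  fix l assume "l \<notin> S''"
  then have "l \<notin> S" "l \<notin> S'" using assms(3) by auto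
  then show "F'' l = F l" using rebalanceD(3)[OF assms(1), of l] rebalanceD(3)[OF assms(2), of l] by simp
qed

definition near :: "('e \<times> bool \<Rightarrow> 'v) \<Rightarrow> 'e set \<Rightarrow> ('v \<Rightarrow> real) \<Rightarrow> real \<Rightarrow> bool" where
  "near h F a r \<longleftrightarrow> (\<forall>v. \<bar>rdeg h F v - a v\<bar> \<le> r)"

lemma nearD: "near h F a r \<Longrightarrow> \<bar>rdeg h F v - a v\<bar> \<le> r"
  by (simp add: near_def)

definition mean :: "('e \<times> bool \<Rightarrow> 'v) \<Rightarrow> 'e set \<Rightarrow> 'e set \<Rightarrow> 'v \<Rightarrow> real" where
  "mean h F F' v = (rdeg h F v + rdeg h F' v) / 2"

text \<open>The union of the two trees is kept, hence also the sum of their degrees; a difference of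
  at most 6 then puts each within 3 of the mean.\<close>

lemma balance_pair:
  assumes F: "tree_family V h I F" and V: "finite V" and ij: "i \<in> I" "j \<in> I" "i \<noteq> j"
  obtains F' where "rebalance V h I {i, j} F F'"
    "near h (F' i) (mean h (F i) (F j)) 3" "near h (F' j) (mean h (F i) (F j)) 3"
proof -
  have Fi: "tree_set V h (F i)" "tree_set V h (F j)" "F i \<inter> F j = {}"
    using F ij by (auto simp: tree_family_def)
  obtain A B where AB: "tree_set V h A" "tree_set V h B" "A \<inter> B = {}" "A \<union> B = F i \<union> F j"
    "\<And>v. \<bar>int (deg h A v) - int (deg h B v)\<bar> \<le> 6"
    by (rule balance_two_tree_sets[OF Fi V]) blast
  define F' where "F' = F(i := A, j := B)"
  have F'i: "F' i = A" "F' j = B" using ij(3) by (auto simp: F'_def)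
  have other: "F' l = F l" if "l \<noteq> i" "l \<noteq> j" for l using that by (simp add: F'_def)
  have disj: "F l \<inter> A = {} \<and> F l \<inter> B = {}" if "l \<in> I" "l \<noteq> i" "l \<noteq> j" for l
  proof -
    have "F l \<inter> F i = {}" "F l \<inter> F j = {}" using F that ij by (auto simp: tree_family_def)
    then show ?thesis using AB(4) by blast
  qed
  have dj': "F' a \<inter> F' b = {}" if ab: "a \<in> I" "b \<in> I" "a \<noteq> b" for a b
  proof -
    have "F a \<inter> F b = {}" using F ab by (auto simp: tree_family_def)
    then show ?thesis using disj[of a] disj[of b] ab AB(3) ij(3) unfolding F'_def by auto
  qed
  have "tree_set V h (F' l)" if "l \<in> I" for l
    using F that AB(1,2) by (auto simp: F'_def tree_family_def)
  then have 1: "tree_family V h I F'" unfolding tree_family_def using dj' by blast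
  have I: "I = insert i (insert j (I - {i, j}))" using ij by auto
  have "\<Union>(F' ` (I - {i, j})) = \<Union>(F ` (I - {i, j}))" using other by auto
  then have 2: "\<Union>(F' ` I) = \<Union>(F ` I)" using AB(4) F'i by (subst (1 2) I) auto
  have s: "rdeg h A v + rdeg h B v = rdeg h (F i) v + rdeg h (F j) v" for v
  proof -
    have "deg h (A \<union> B) v = deg h A v + deg h B v"
      using AB(1-3) by (intro deg_Un_disjoint) (auto simp: tree_set_def)
    moreover have "deg h (F i \<union> F j) v = deg h (F i) v + deg h (F j) v"
      using Fi by (intro deg_Un_disjoint) (auto simp: tree_set_def)
    ultimately show ?thesis unfolding rdeg_def AB(4) by linarith
  qed
  have dd: "\<bar>rdeg h A v - rdeg h B v\<bar> \<le> 6" for v using AB(5)[of v] unfolding rdeg_def by linarith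
  have "rebalance V h I {i, j} F F'" using 1 2 other by (simp add: rebalance_def)
  moreover have "near h A (mean h (F i) (F j)) 3" "near h B (mean h (F i) (F j)) 3"
    unfolding near_def mean_def s[symmetric] using dd by (auto simp: abs_le_iff field_simps)
  ultimately show ?thesis using that[of F'] F'i by simp
qed

text \<open>The pairs of \<open>i\<close> and \<open>\<phi> i\<close> are disjoint, so they can be
  balanced one after the other without disturbing each other.\<close>

lemma balance_matching:
  assumes "finite M" "tree_family V h I F" "finite V" "M \<subseteq> I" "\<phi> ` M \<subseteq> I" "inj_on \<phi> M" "M \<inter> \<phi> ` M = {}"
  shows "\<exists>F'. rebalance V h I (M \<union> \<phi> ` M) F F' \<and>
    (\<forall>i \<in> M. near h (F' i) (mean h (F i) (F (\<phi> i))) 3 \<and> near h (F' (\<phi> i)) (mean h (F i) (F (\<phi> i))) 3)"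
  using assms
proof (induction M rule: finite_induct)
  case empty
  then show ?case by (intro exI[of _ F]) (simp add: rebalance_def)
next
  case (insert x M)
  have "\<exists>F'. rebalance V h I (M \<union> \<phi> ` M) F F' \<and>
    (\<forall>i \<in> M. near h (F' i) (mean h (F i) (F (\<phi> i))) 3 \<and> near h (F' (\<phi> i)) (mean h (F i) (F (\<phi> i))) 3)"
  proof (rule insert.IH)
    show "M \<subseteq> I" "\<phi> ` M \<subseteq> I" "inj_on \<phi> M" "M \<inter> \<phi> ` M = {}"
      using insert.prems(3-6) by auto
  qed (rule insert.prems)+
  then obtain G where G: "rebalance V h I (M \<union> \<phi> ` M) F G" and
    GM: "\<forall>i \<in> M. near h (G i) (mean h (F i) (F (\<phi> i))) 3 \<and> near h (G (\<phi> i)) (mean h (F i) (F (\<phi> i))) 3"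
    by (elim exE conjE)
  have x: "x \<notin> M" "x \<notin> \<phi> ` M" "\<phi> x \<notin> M" "\<phi> x \<notin> \<phi> ` M" "x \<noteq> \<phi> x" "x \<in> I" "\<phi> x \<in> I"
    using insert.hyps insert.prems by auto
  obtain H where H: "rebalance V h I {x, \<phi> x} G H"
    "near h (H x) (mean h (G x) (G (\<phi> x))) 3" "near h (H (\<phi> x)) (mean h (G x) (G (\<phi> x))) 3"
    by (rule balance_pair[OF rebalanceD(1)[OF G] insert.prems(2) x(6,7,5)])
  have Gx: "G x = F x" "G (\<phi> x) = F (\<phi> x)" using rebalanceD(3)[OF G] x by simp_all
  have HG: "H i = G i" "H (\<phi> i) = G (\<phi> i)" if i: "i \<in> M" for i
  proof -
    have "i \<noteq> x" "i \<noteq> \<phi> x" "\<phi> i \<noteq> x" "\<phi> i \<noteq> \<phi> x" using x i by (metis imageI)+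
    then show "H i = G i" "H (\<phi> i) = G (\<phi> i)" using rebalanceD(3)[OF H(1)] by simp_all
  qed
  show ?case
  proof (intro exI[of _ H] conjI ballI)
    show "rebalance V h I (insert x M \<union> \<phi> ` insert x M) F H"
    proof (rule rebalance_trans[OF G H(1)])
      show "M \<union> \<phi> ` M \<union> {x, \<phi> x} \<subseteq> insert x M \<union> \<phi> ` insert x M" by blast
    qed
    fix i assume i: "i \<in> insert x M"
    have "near h (H i) (mean h (F i) (F (\<phi> i))) 3 \<and> near h (H (\<phi> i)) (mean h (F i) (F (\<phi> i))) 3"
    proof (cases "i = x")
      case True
      show ?thesis using H(2,3) unfolding Gx True by (rule conjI)
    next
      case False
      then have "i \<in> M" using i by simp
      then show ?thesis using bspec[OF GM] HG[of i] by metis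
    qed
    then show "near h (H i) (mean h (F i) (F (\<phi> i))) 3" "near h (H (\<phi> i)) (mean h (F i) (F (\<phi> i))) 3"
      by simp_all
  qed
qed

section \<open>The butterfly pattern on a power of two\<close>

definition average :: "('e \<times> bool \<Rightarrow> 'v) \<Rightarrow> (nat \<Rightarrow> 'e set) \<Rightarrow> nat set \<Rightarrow> 'v \<Rightarrow> real" where
  "average h F S v = (\<Sum>j \<in> S. rdeg h (F j) v) / real (card S)"

text \<open>Both halves are brought near their own averages, then each tree of one half is balanced
  against a tree of the other. The mean of the two averages is the average over \<open>S\<close>;
  the two errors average to at most \<open>3 * real m\<close>, and the last round adds 3.\<close>

lemma balance_power_of_two:
  assumes "tree_family V h I F" "finite V" "S \<subseteq> I" "card S = 2 ^ m"
  shows "\<exists>F'. rebalance V h I S F F' \<and> (\<forall>i \<in> S. near h (F' i) (average h F S) (3 * real m))"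
  using assms
proof (induction m arbitrary: F S)
  case 0
  then have "card S = 1" by simp
  then obtain i where i: "S = {i}" by (rule card_1_singletonE)
  have "rebalance V h I S F F" using 0 by (simp add: rebalance_def)
  moreover have "near h (F i) (average h F S) (3 * real 0)" by (simp add: near_def average_def i)
  ultimately show ?case unfolding i by (intro exI[of _ F]) simp
next
  case (Suc m)
  have fS: "finite S" by (rule ccontr) (use Suc.prems(4) in simp)
  have "(2::nat) ^ m \<le> card S" using Suc.prems(4) by simp
  then obtain S1 where S1: "S1 \<subseteq> S" "card S1 = 2 ^ m" "finite S1"
    by (rule obtain_subset_with_card_n)
  define S2 where "S2 = S - S1"
  have S2: "S2 \<subseteq> S" "card S2 = 2 ^ m" "finite S2" "S1 \<inter> S2 = {}" "S = S1 \<union> S2"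
    unfolding S2_def using S1(1) fS by (simp, simp add: card_Diff_subset S1 Suc.prems(4), simp, blast, blast)
  have sub: "S1 \<subseteq> I" "S2 \<subseteq> I" using S1(1) S2(1) Suc.prems(3) by auto
  obtain G where G: "rebalance V h I S1 F G" and
    G1: "\<forall>i \<in> S1. near h (G i) (average h F S1) (3 * real m)"
    using Suc.IH[OF Suc.prems(1,2) sub(1) S1(2)] by (elim exE conjE)
  obtain H where H: "rebalance V h I S2 G H" and
    H2: "\<forall>i \<in> S2. near h (H i) (average h G S2) (3 * real m)"
    using Suc.IH[OF rebalanceD(1)[OF G] Suc.prems(2) sub(2) S2(2)] by (elim exE conjE)
  \<comment> \<open>Work on the first half does not touch the second, so the average over
    \<open>S2\<close> is still that of \<open>F\<close>.\<close>
  have "G j = F j" if "j \<in> S2" for j using rebalanceD(3)[OF G, of j] S2(4) that by auto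
  then have "(\<Sum>j \<in> S2. rdeg h (G j) v) = (\<Sum>j \<in> S2. rdeg h (F j) v)" for v
    by (intro sum.cong refl) simp
  then have avg2: "average h G S2 = average h F S2" by (simp add: average_def fun_eq_iff)
  obtain \<phi> where \<phi>: "bij_betw \<phi> S1 S2"
    using finite_same_card_bij[OF S1(3) S2(3)] S1(2) S2(2) by auto
  have im: "\<phi> ` S1 = S2" "inj_on \<phi> S1" using \<phi> by (simp_all add: bij_betw_def)
  have pre: "\<phi> ` S1 \<subseteq> I" "S1 \<inter> \<phi> ` S1 = {}" unfolding im(1) by (rule sub(2), rule S2(4))
  obtain K where K: "rebalance V h I (S1 \<union> \<phi> ` S1) H K" and
    K1: "\<forall>i \<in> S1. near h (K i) (mean h (H i) (H (\<phi> i))) 3 \<and> near h (K (\<phi> i)) (mean h (H i) (H (\<phi> i))) 3"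
    using balance_matching[OF S1(3) rebalanceD(1)[OF H] Suc.prems(2) sub(1) pre(1) im(2) pre(2)]
    by (elim exE conjE)
  have avgS: "average h F S v = (average h F S1 v + average h F S2 v) / 2" for v
  proof -
    have "(\<Sum>j \<in> S. rdeg h (F j) v) = (\<Sum>j \<in> S1. rdeg h (F j) v) + (\<Sum>j \<in> S2. rdeg h (F j) v)"
      unfolding S2(5) by (rule sum.union_disjoint[OF S1(3) S2(3,4)])
    then show ?thesis unfolding average_def Suc.prems(4) S1(2) S2(2) by (simp add: field_simps)
  qed
  have avgS: "average h F S v = (average h F S1 v + average h F S2 v) / 2" for v
  proof -
    have "(\<Sum>j \<in> S. rdeg h (F j) v) = (\<Sum>j \<in> S1. rdeg h (F j) v) + (\<Sum>j \<in> S2. rdeg h (F j) v)"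
      unfolding S2(5) by (rule sum.union_disjoint[OF S1(3) S2(3,4)])
    then show ?thesis unfolding average_def Suc.prems(4) S1(2) S2(2) by (simp add: add_divide_distrib)
  qed
  have bound: "near h X (average h F S) (3 * real (Suc m))"
    if i: "i \<in> S1" and X: "near h X (mean h (H i) (H (\<phi> i))) 3" for i X
    unfolding near_def
  proof
    fix v
    have iS: "i \<notin> S2" "\<phi> i \<in> S2" using i S2(4) im(1) by blast+
    have "\<bar>rdeg h (H i) v - average h F S1 v\<bar> \<le> 3 * real m"
      using nearD[OF bspec[OF G1 i], of v] unfolding rebalanceD(3)[OF H iS(1)] .
    moreover have "\<bar>rdeg h (H (\<phi> i)) v - average h F S2 v\<bar> \<le> 3 * real m"
      using nearD[OF bspec[OF H2 iS(2)], of v] unfolding avg2 .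
    ultimately show "\<bar>rdeg h X v - average h F S v\<bar> \<le> 3 * real (Suc m)"
      using nearD[OF X, of v] unfolding avgS mean_def of_nat_Suc by argo
  qed
  show ?case
  proof (intro exI[of _ K] conjI ballI)
    have GH: "rebalance V h I S F H" by (rule rebalance_trans[OF G H]) (use S2(5) in simp)
    show "rebalance V h I S F K" by (rule rebalance_trans[OF GH K]) (use S2(5) im in simp)
    fix i assume "i \<in> S"
    then consider "i \<in> S1" | j where "j \<in> S1" "i = \<phi> j" using S2(5) im(1) by blast
    then show "near h (K i) (average h F S) (3 * real (Suc m))"
    proof cases
      case 1
      show ?thesis using bspec[OF K1 1] by (intro bound[OF 1]) (rule conjunct1)
    next
      case 2
      show ?thesis unfolding 2(2) using bspec[OF K1 2(1)] by (intro bound[OF 2(1)]) (rule conjunct2)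
    qed
  qed
qed

lemma abs_average_le:
  assumes "\<And>j. j \<in> S \<Longrightarrow> \<bar>x - rdeg h (F j) v\<bar> \<le> D" "finite S" "S \<noteq> {}"
  shows "\<bar>x - average h F S v\<bar> \<le> D"
proof -
  have c: "real (card S) > 0" using assms(2,3) by (simp add: card_gt_0_iff)
  have "x - average h F S v = (\<Sum>j \<in> S. x - rdeg h (F j) v) / real (card S)"
    unfolding average_def using c by (simp add: sum_subtractf diff_divide_distrib)
  also have "\<bar>\<dots>\<bar> = \<bar>\<Sum>j \<in> S. x - rdeg h (F j) v\<bar> / real (card S)" by (simp add: abs_divide)
  also have "\<dots> \<le> (\<Sum>j \<in> S. \<bar>x - rdeg h (F j) v\<bar>) / real (card S)"
    by (intro divide_right_mono sum_abs) simp
  also have "\<dots> \<le> (\<Sum>j \<in> S. D) / real (card S)"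
    using assms(1) by (intro divide_right_mono sum_mono) auto
  also have "\<dots> = D" using c by simp
  finally show ?thesis .
qed

section \<open>Halving the largest difference\<close>

definition spread_le :: "('e \<times> bool \<Rightarrow> 'v) \<Rightarrow> nat set \<Rightarrow> (nat \<Rightarrow> 'e set) \<Rightarrow> real \<Rightarrow> bool" where
  "spread_le h I F D \<longleftrightarrow> (\<forall>i \<in> I. \<forall>j \<in> I. \<forall>v. \<bar>rdeg h (F i) v - rdeg h (F j) v\<bar> \<le> D)"

lemma spread_leD: "spread_le h I F D \<Longrightarrow> i \<in> I \<Longrightarrow> j \<in> I \<Longrightarrow> \<bar>rdeg h (F i) v - rdeg h (F j) v\<bar> \<le> D"
  by (simp add: spread_le_def)

text \<open>Every tree outside \<open>S\<close> is balanced against its own partner in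
  \<open>S\<close>, which is already near the average \<open>a\<close>. Each result is near
  \<open>a\<close> or near the midpoint of \<open>a\<close> and an old degree, and such values
  differ by at most about \<open>D / 2\<close>.\<close>

lemma halve_spread:
  assumes F: "tree_family V h I F" "finite V" and I: "finite I" "2 ^ m \<le> card I" "card I < 2 ^ Suc m"
    and m: "1 \<le> m" and D: "spread_le h I F D"
  shows "\<exists>F'. rebalance V h I I F F' \<and> spread_le h I F' (D / 2 + 6 * real m + 3)"
proof -
  obtain S where S: "S \<subseteq> I" "card S = 2 ^ m" "finite S" by (rule obtain_subset_with_card_n[OF I(2)])
  define R where "R = I - S"
  have "card R = card I - card S" unfolding R_def by (rule card_Diff_subset[OF S(3,1)])
  \<comment> \<open>The upper bound on \<open>card I\<close> guarantees enough partners.\<close>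
  then have Rc: "card R \<le> card S" using I(3) S(2) by simp
  have R: "finite R" "R \<inter> S = {}" "I = R \<union> S" "R \<subseteq> I"
    unfolding R_def using S(1) I(1) by (simp, blast, blast, blast)
  obtain G where G: "rebalance V h I S F G" and
    GS: "\<forall>i \<in> S. near h (G i) (average h F S) (3 * real m)"
    using balance_power_of_two[OF F S(1,2)] by (elim exE conjE)
  define a where "a = average h F S"
  have ne: "S \<noteq> {}" using S(2) by auto
  have avg: "\<bar>rdeg h (F i) v - a v\<bar> \<le> D" if "i \<in> I" for i v
    unfolding a_def
  proof (rule abs_average_le[OF _ S(3) ne])
    fix j assume "j \<in> S"
    then show "\<bar>rdeg h (F i) v - rdeg h (F j) v\<bar> \<le> D" using S(1) by (intro spread_leD[OF D that]) blast
  qed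
  obtain \<phi> where \<phi>: "\<phi> ` R \<subseteq> S" "inj_on \<phi> R" using card_le_inj[OF R(1) S(3) Rc] by blast
  have pre: "\<phi> ` R \<subseteq> I" "R \<inter> \<phi> ` R = {}" using \<phi>(1) S(1) R(2) by blast+
  obtain K where K: "rebalance V h I (R \<union> \<phi> ` R) G K" and
    KR: "\<forall>i \<in> R. near h (K i) (mean h (G i) (G (\<phi> i))) 3 \<and> near h (K (\<phi> i)) (mean h (G i) (G (\<phi> i))) 3"
    using balance_matching[OF R(1) rebalanceD(1)[OF G] F(2) R(4) pre(1) \<phi>(2) pre(2)] by (elim exE conjE)
  \<comment> \<open>The error consists of half the error of the partner and the 3 from balancing the
    pair. A balanced partner has this shape as well.\<close>
  have shape: "(\<exists>i \<in> I. near h (K l) (\<lambda>v. (rdeg h (F i) v + a v) / 2) (3 * real m / 2 + 3)) \<or>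
      near h (K l) a (3 * real m)" if l: "l \<in> I" for l
  proof (cases "l \<in> R \<union> \<phi> ` R")
    case True
    then obtain i where i: "i \<in> R" "l = i \<or> l = \<phi> i" by blast
    have iS: "i \<notin> S" "\<phi> i \<in> S" "i \<in> I" using i(1) R(2,4) \<phi>(1) by blast+
    have Kl: "near h (K l) (mean h (G i) (G (\<phi> i))) 3" using bspec[OF KR i(1)] i(2) by metis
    have "near h (K l) (\<lambda>v. (rdeg h (F i) v + a v) / 2) (3 * real m / 2 + 3)"
      unfolding near_def
    proof
      fix v
      have "\<bar>rdeg h (G (\<phi> i)) v - a v\<bar> \<le> 3 * real m"
        unfolding a_def by (rule nearD[OF bspec[OF GS iS(2)]])
      moreover have "\<bar>rdeg h (K l) v - (rdeg h (F i) v + rdeg h (G (\<phi> i)) v) / 2\<bar> \<le> 3"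
        using nearD[OF Kl, of v] unfolding mean_def rebalanceD(3)[OF G iS(1)] .
      ultimately show "\<bar>rdeg h (K l) v - (rdeg h (F i) v + a v) / 2\<bar> \<le> 3 * real m / 2 + 3" by argo
    qed
    then show ?thesis using iS(3) by blast
  next
    case False
    then have "l \<in> S" "K l = G l" using l R(3) rebalanceD(3)[OF K, of l] by blast+
    then show ?thesis using bspec[OF GS, of l] unfolding a_def by simp
  qed
  \<comment> \<open>For two midpoints the error is \<open>3 * m + 6\<close>, which is at most
    \<open>6 * m + 3\<close> because \<open>1 \<le> m\<close>.\<close>
  have rm: "1 \<le> real m" using m by simp
  have D0: "0 \<le> D"
  proof -
    obtain i where "i \<in> I" using S(1) ne by blast
    then show ?thesis using spread_leD[OF D, of i i] by simp
  qed
  have "\<bar>rdeg h (K i) v - rdeg h (K j) v\<bar> \<le> D / 2 + 6 * real m + 3" if ij: "i \<in> I" "j \<in> I" for i j v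
    using shape[OF ij(1)] shape[OF ij(2)]
  proof (elim disjE bexE)
    fix i' j' assume *: "i' \<in> I" "j' \<in> I"
      "near h (K i) (\<lambda>v. (rdeg h (F i') v + a v) / 2) (3 * real m / 2 + 3)"
      "near h (K j) (\<lambda>v. (rdeg h (F j') v + a v) / 2) (3 * real m / 2 + 3)"
    show ?thesis using nearD[OF *(3), of v] nearD[OF *(4), of v] spread_leD[OF D *(1,2), of v] rm by argo
  next
    fix i' assume *: "i' \<in> I" "near h (K j) a (3 * real m)"
      "near h (K i) (\<lambda>v. (rdeg h (F i') v + a v) / 2) (3 * real m / 2 + 3)"
    show ?thesis using nearD[OF *(2), of v] nearD[OF *(3), of v] avg[OF *(1), of v] rm by argo
  next
    fix j' assume *: "j' \<in> I" "near h (K i) a (3 * real m)"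
      "near h (K j) (\<lambda>v. (rdeg h (F j') v + a v) / 2) (3 * real m / 2 + 3)"
    show ?thesis using nearD[OF *(2), of v] nearD[OF *(3), of v] avg[OF *(1), of v] rm by argo
  next
    assume *: "near h (K i) a (3 * real m)" "near h (K j) a (3 * real m)"
    show ?thesis using nearD[OF *(1), of v] nearD[OF *(2), of v] rm D0 by argo
  qed
  then have "spread_le h I K (D / 2 + 6 * real m + 3)" by (simp add: spread_le_def)
  moreover have "rebalance V h I I F K" by (rule rebalance_trans[OF G K]) (use S(1) R(4) pre in blast)
  ultimately show ?thesis by blast
qed

text \<open>\<open>12 * m + 6\<close> is the fixed point of
  \<open>D \<mapsto> D / 2 + 6 * m + 3\<close>; a least spread above it could be lowered by
  \<open>halve_spread\<close>.\<close>

lemma balanced_tree_family: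
  assumes F: "tree_family V h I F" "finite V" and I: "finite I" "2 ^ m \<le> card I" "card I < 2 ^ Suc m"
    and m: "1 \<le> m"
  shows "\<exists>F'. rebalance V h I I F F' \<and> spread_le h I F' (12 * real m + 6)"
proof -
  define ok where "ok n F' \<longleftrightarrow> rebalance V h I I F F' \<and> spread_le h I F' (real n)" for n :: nat and F'
  \<comment> \<open>A crude bound, which ensures that some natural number bounds the spread.\<close>
  have le: "rdeg h (F i) v \<le> real (2 * card V)" if "i \<in> I" for i v
  proof -
    have t: "finite (F i)" "card (F i) + 1 = card V" using F(1) that by (simp_all add: tree_family_def tree_set_def)
    have "deg h (F i) v \<le> card (F i \<times> (UNIV :: bool set))"
      unfolding deg_def using t(1) by (intro card_mono) auto
    also have "\<dots> \<le> 2 * card V" using t(2) by (simp add: card_cartesian_product)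
    finally show ?thesis unfolding rdeg_def by linarith
  qed
  have "\<bar>rdeg h (F i) v - rdeg h (F j) v\<bar> \<le> real (2 * card V)" if "i \<in> I" "j \<in> I" for i j v
  proof -
    have "0 \<le> rdeg h (F i) v" "0 \<le> rdeg h (F j) v" by (simp_all add: rdeg_def)
    then show ?thesis using le[OF that(1), of v] le[OF that(2), of v] by linarith
  qed
  then have "spread_le h I F (real (2 * card V))" unfolding spread_le_def by blast
  then have "ok (2 * card V) F" using F by (simp add: ok_def rebalance_def)
  then have ex: "\<exists>n. \<exists>F'. ok n F'" by blast
  define n where "n = (LEAST n. \<exists>F'. ok n F')"
  obtain G where G: "ok n G" using LeastI_ex[OF ex] unfolding n_def by blast
  have GG: "rebalance V h I I F G" "spread_le h I G (real n)" using G by (simp_all add: ok_def)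
  have "real n \<le> 12 * real m + 6"
  proof (rule ccontr)
    assume "\<not> real n \<le> 12 * real m + 6"
    then have big: "real n / 2 + 6 * real m + 3 < real n" by linarith
    obtain H where H: "rebalance V h I I G H" "spread_le h I H (real n / 2 + 6 * real m + 3)"
      using halve_spread[OF rebalanceD(1)[OF GG(1)] F(2) I m GG(2)] by (elim exE conjE)
    have "0 < real n" using big by linarith
    then have n0: "n \<noteq> 0" by simp
    \<comment> \<open>Degrees are integers, so a spread below \<open>n\<close> is at most
      \<open>n - 1\<close>.\<close>
    have "\<bar>rdeg h (H i) v - rdeg h (H j) v\<bar> \<le> real (n - 1)" if "i \<in> I" "j \<in> I" for i j v
    proof -
      have "\<bar>rdeg h (H i) v - rdeg h (H j) v\<bar> < real n" using spread_leD[OF H(2) that, of v] big by linarith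
      then have "\<bar>int (deg h (H i) v) - int (deg h (H j) v)\<bar> < int n" unfolding rdeg_def by linarith
      then have "\<bar>int (deg h (H i) v) - int (deg h (H j) v)\<bar> \<le> int (n - 1)" by linarith
      then show ?thesis unfolding rdeg_def by linarith
    qed
    then have "spread_le h I H (real (n - 1))" unfolding spread_le_def by blast
    moreover have "rebalance V h I I F H" by (rule rebalance_trans[OF GG(1) H(1)]) simp
    ultimately have "ok (n - 1) H" by (simp add: ok_def)
    then have "n \<le> n - 1" unfolding n_def by (intro Least_le) blast
    then show False using n0 by linarith
  qed
  then have "spread_le h I G (12 * real m + 6)" using GG(2) unfolding spread_le_def by (meson order_trans)
  then show ?thesis using GG(1) by blast
qed

section \<open>Trees as sparse edge sets\<close>

definition adj :: "('e \<Rightarrow> 'v set) \<Rightarrow> 'e set \<Rightarrow> ('v \<times> 'v) set" where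
  "adj en Q = {(a, b). \<exists>e \<in> Q. en e = {a, b}}"

text \<open>Repeated vertices are avoided by cutting the path off where the next vertex already
  occurs.\<close>

lemma adj_path:
  assumes "(u, v) \<in> (adj en Q)\<^sup>*"
  shows "\<exists>vs es. length vs = Suc (length es) \<and> hd vs = u \<and> last vs = v \<and> distinct vs \<and> set es \<subseteq> Q \<and>
    (\<forall>i < length es. en (es ! i) = {vs ! i, vs ! Suc i})"
  using assms
proof (induction rule: rtrancl_induct)
  case base
  show ?case by (intro exI[of _ "[u]"] exI[of _ "[]"]) simp
next
  case (step b c)
  obtain vs es where w: "length vs = Suc (length es)" "hd vs = u" "last vs = b" "distinct vs" "set es \<subseteq> Q"
    "\<And>i. i < length es \<Longrightarrow> en (es ! i) = {vs ! i, vs ! Suc i}" using step.IH by blast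
  obtain e where e: "e \<in> Q" "en e = {b, c}" using step.hyps(2) by (auto simp: adj_def)
  show ?case
  proof (cases "c \<in> set vs")
    case True
    then obtain n where n: "n < length vs" "vs ! n = c" by (auto simp: in_set_conv_nth)
    have "length (take (Suc n) vs) = Suc (length (take n es))" using n(1) w(1) by simp
    moreover have "hd (take (Suc n) vs) = u" using w(2) by simp
    moreover have "last (take (Suc n) vs) = c" using n by (simp add: take_Suc_conv_app_nth)
    moreover have "distinct (take (Suc n) vs)" using w(4) by simp
    moreover have "set (take n es) \<subseteq> Q" using w(5) set_take_subset[of n es] by blast
    moreover have "en (take n es ! i) = {take (Suc n) vs ! i, take (Suc n) vs ! Suc i}"
      if "i < length (take n es)" for i using that w(6)[of i] by simp
    ultimately show ?thesis by blast
  next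
    case False
    have ne: "vs \<noteq> []" using w(1) by auto
    have "length (vs @ [c]) = Suc (length (es @ [e]))" using w(1) by simp
    moreover have "hd (vs @ [c]) = u" using w(2) ne by simp
    moreover have "last (vs @ [c]) = c" by simp
    moreover have "distinct (vs @ [c])" using w(4) False by simp
    moreover have "set (es @ [e]) \<subseteq> Q" using w(5) e(1) by simp
    moreover have "en ((es @ [e]) ! i) = {(vs @ [c]) ! i, (vs @ [c]) ! Suc i}"
      if i: "i < length (es @ [e])" for i
    proof (cases "i < length es")
      case True
      then show ?thesis using w(6)[OF True] w(1) by (simp add: nth_append)
    next
      case False
      then have "i = length es" using i by simp
      moreover have "vs ! length es = b" using w(1,3) ne by (simp add: last_conv_nth)
      ultimately show ?thesis using w(1) e(2) by (simp add: nth_append)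
    qed
    ultimately show ?thesis by blast
  qed
qed

text \<open>An arbitrary order of the two ends of each edge links \<open>ends\<close> with a map on
  half-edges.\<close>

definition half_edges :: "('v, 'e) multigraph \<Rightarrow> ('e \<times> bool \<Rightarrow> 'v) \<Rightarrow> bool" where
  "half_edges G h \<longleftrightarrow> (\<forall>e \<in> edges G. ends G e = {h (e, True), h (e, False)})"

lemma half_edges_exist:
  assumes "multigraph G"
  shows "\<exists>h. half_edges G h"
proof -
  have "\<forall>e \<in> edges G. \<exists>p. ends G e = {fst p, snd p}"
  proof
    fix e assume "e \<in> edges G"
    then have "card (ends G e) = 2" using assms by (simp add: multigraph_def)
    then obtain a b where "ends G e = {a, b}" by (meson card_2_iff)
    then show "\<exists>p. ends G e = {fst p, snd p}" by (intro exI[of _ "(a, b)"]) simp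
  qed
  then obtain f where f: "\<forall>e \<in> edges G. ends G e = {fst (f e), snd (f e)}" by metis
  then have "half_edges G (\<lambda>(e, i). if i then fst (f e) else snd (f e))" by (simp add: half_edges_def)
  then show ?thesis by blast
qed

lemma vset_eq_Union_ends:
  assumes "half_edges G h" "Q \<subseteq> edges G"
  shows "vset h Q = (\<Union>e \<in> Q. ends G e)"
proof -
  have "(\<Union>e \<in> Q. ends G e) = (\<Union>e \<in> Q. {h (e, True), h (e, False)})"
    using assms by (intro SUP_cong refl) (auto simp: half_edges_def)
  also have "\<dots> = vset h Q" by (auto simp: vset_def UNIV_bool)
  finally show ?thesis by simp
qed

text \<open>\<open>X\<close> is the component of \<open>u\<close>, and adjacency is
  symmetric.\<close>

lemma ends_subset_or_disjoint:
  assumes "card (en f) = 2" "f \<in> R" "X = {x. (u, x) \<in> (adj en R)\<^sup>*}"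
  shows "en f \<subseteq> X \<or> en f \<inter> X = {}"
proof -
  obtain a b where ab: "en f = {a, b}" using assms(1) by (meson card_2_iff)
  then have "(a, b) \<in> adj en R" "(b, a) \<in> adj en R" using assms(2) by (auto simp: adj_def insert_commute)
  then have "a \<in> X \<longleftrightarrow> b \<in> X" unfolding assms(3) by (auto intro: rtrancl.rtrancl_into_rtrancl)
  then show ?thesis using ab by auto
qed

section \<open>Trees recognised by counting\<close>

text \<open>Without the edge \<open>e\<close> its ends \<open>u\<close> and \<open>v\<close> lie in
  different components. The edges in the component of \<open>u\<close> and the rest, taken with
  \<open>u\<close> and \<open>v\<close> respectively, each have fewer edges than vertices, and
  \<open>e\<close> uses up one of the two surpluses.\<close>

lemma acyclic_sparse:
  assumes G: "multigraph G" "half_edges G h" and ac: "\<nexists>vs es. cycle G vs es"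
    and Q: "Q \<subseteq> edges G" "Q \<noteq> {}"
  shows "card Q + 1 \<le> card (vset h Q)"
  using Q
proof (induction "card Q" arbitrary: Q rule: less_induct)
  case less
  let ?en = "ends G"
  have fin: "finite (edges G)" and ends: "e \<in> edges G \<Longrightarrow> ?en e \<subseteq> verts G \<and> card (?en e) = 2" for e
    using G(1) by (auto simp: multigraph_def)
  have fQ: "finite Q" using less.prems(1) fin by (rule finite_subset)
  obtain e where e: "e \<in> Q" using less.prems(2) by blast
  then have eG: "e \<in> edges G" using less.prems(1) by blast
  obtain u v where uv: "?en e = {u, v}" "u \<noteq> v" using ends[OF eG] by (meson card_2_iff)
  define R where "R = Q - {e}"
  have RG: "R \<subseteq> edges G" using less.prems(1) by (auto simp: R_def)
  define X where "X = {x. (u, x) \<in> (adj ?en R)\<^sup>*}"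
  \<comment> \<open>A path from \<open>u\<close> to \<open>v\<close> avoiding \<open>e\<close>
    closes to a cycle with \<open>e\<close>; a single parallel edge gives a cycle of length
    2.\<close>
  have vX: "v \<notin> X"
  proof
    assume "v \<in> X"
    then obtain vs es where w: "length vs = Suc (length es)" "hd vs = u" "last vs = v" "distinct vs"
      "set es \<subseteq> R" "\<And>i. i < length es \<Longrightarrow> ?en (es ! i) = {vs ! i, vs ! Suc i}"
      using adj_path[of u v ?en R] unfolding X_def by blast
    have ne: "vs \<noteq> []" using w(1) by auto
    have first: "vs ! 0 = u" and lst: "vs ! length es = v"
      using w(1-3) ne by (simp_all add: hd_conv_nth last_conv_nth)
    then have "length es \<noteq> 0" using uv(2) by metis
    have "cycle G vs (es @ [e])"
      unfolding cycle_def
    proof (intro conjI allI impI)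
      show "length vs = length (es @ [e])" using w(1) by simp
      show "2 \<le> length (es @ [e])" using \<open>length es \<noteq> 0\<close> by (simp add: Suc_le_eq)
      show "set (es @ [e]) \<subseteq> edges G" using w(5) RG eG by auto
      show "distinct vs" by (rule w(4))
      \<comment> \<open>An edge used twice would have the same ends at two positions, and some
        vertex of the path would repeat.\<close>
      have "distinct es"
        unfolding distinct_conv_nth
      proof (intro allI impI)
        fix i j assume ij: "i < length es" "j < length es" "i \<noteq> j"
        show "es ! i \<noteq> es ! j"
        proof
          assume "es ! i = es ! j"
          then have eq: "{vs ! i, vs ! Suc i} = {vs ! j, vs ! Suc j}" using w(6)[OF ij(1)] w(6)[OF ij(2)] by simp
          have inj: "vs ! a = vs ! b \<longleftrightarrow> a = b" if "a \<le> length es" "b \<le> length es" for a b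
            using nth_eq_iff_index_eq[OF w(4)] that w(1) by simp
          have "vs ! i = vs ! j \<or> vs ! i = vs ! Suc j \<and> vs ! Suc i = vs ! j"
            using eq by (auto simp: doubleton_eq_iff)
          then show False using inj[of i j] inj[of i "Suc j"] inj[of "Suc i" j] ij by auto
        qed
      qed
      moreover have "e \<notin> set es" using w(5) by (auto simp: R_def)
      ultimately show "distinct (es @ [e])" by simp
    next
      fix i assume i: "i < length (es @ [e])"
      show "?en ((es @ [e]) ! i) = {vs ! i, vs ! (Suc i mod length vs)}"
      proof (cases "i < length es")
        case True
        then show ?thesis using w(6)[OF True] w(1) by (simp add: nth_append)
      next
        case False
        then have "i = length es" using i by simp
        then show ?thesis using w(1) first lst uv(1) by (simp add: nth_append insert_commute)
      qed
    next
      show "set vs \<subseteq> verts G"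
      proof
        fix x assume "x \<in> set vs"
        then obtain i where i: "i < length vs" "x = vs ! i" by (auto simp: in_set_conv_nth)
        show "x \<in> verts G"
        proof (cases "i < length es")
          case True
          then have "es ! i \<in> edges G" using w(5) RG nth_mem[OF True] by blast
          then show ?thesis using ends[of "es ! i"] w(6)[OF True] i by auto
        next
          case False
          then have "x = v" using i w(1) lst by (simp add: less_Suc_eq)
          then show ?thesis using ends[OF eG] uv by auto
        qed
      qed
    qed
    then show False using ac by blast
  qed
  define R1 where "R1 = {f \<in> R. ?en f \<subseteq> X}"
  define R2 where "R2 = R - R1"
  have R12: "R1 \<subseteq> edges G" "R2 \<subseteq> edges G" "finite R1" "finite R2"
    using RG fQ by (auto simp: R1_def R2_def R_def)
  have lt: "card R1 < card Q" "card R2 < card Q"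
    using fQ e by (auto intro!: psubset_card_mono simp: R1_def R2_def R_def)
  have V1: "vset h R1 \<subseteq> X" unfolding vset_eq_Union_ends[OF G(2) R12(1)] by (auto simp: R1_def)
  have dis: "?en f \<inter> X = {}" if "f \<in> R2" for f
    using that ends[of f] RG ends_subset_or_disjoint[of ?en f R X u] unfolding R1_def R2_def X_def by blast
  have V2: "vset h R2 \<inter> X = {}"
    unfolding vset_eq_Union_ends[OF G(2) R12(2)] using dis by blast
  have uX: "u \<in> X" by (simp add: X_def)
  \<comment> \<open>Inserting \<open>u\<close> covers the case without edges on this side, where one
    vertex is still needed.\<close>
  have c1: "card R1 + 1 \<le> card (insert u (vset h R1))"
  proof (cases "R1 = {}")
    case False
    then have "card R1 + 1 \<le> card (vset h R1)" using less.hyps[OF lt(1) R12(1)] by blast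
    also have "\<dots> \<le> card (insert u (vset h R1))" by (rule card_insert_le)
    finally show ?thesis .
  qed simp
  have c2: "card R2 + 1 \<le> card (insert v (vset h R2))"
  proof (cases "R2 = {}")
    case False
    then have "card R2 + 1 \<le> card (vset h R2)" using less.hyps[OF lt(2) R12(2)] by blast
    also have "\<dots> \<le> card (insert v (vset h R2))" by (rule card_insert_le)
    finally show ?thesis .
  qed simp
  have "insert u (vset h R1) \<inter> insert v (vset h R2) = {}" using V1 V2 uX vX by blast
  then have "card (insert u (vset h R1)) + card (insert v (vset h R2)) =
      card (insert u (vset h R1) \<union> insert v (vset h R2))"
    using R12 by (intro card_Un_disjoint[symmetric]) simp_all
  also have "\<dots> \<le> card (vset h Q)"
  proof (rule card_mono)
    have "vset h {e} = {u, v}" using vset_eq_Union_ends[OF G(2), of "{e}"] eG uv(1) by simp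
    moreover have "{e} \<subseteq> Q" "R1 \<subseteq> Q" "R2 \<subseteq> Q" using e by (auto simp: R1_def R2_def R_def)
    ultimately show "insert u (vset h R1) \<union> insert v (vset h R2) \<subseteq> vset h Q"
      using vset_mono[of "{e}" Q h] vset_mono[of R1 Q h] vset_mono[of R2 Q h] by auto
  qed (use fQ in simp)
  finally have c: "card (insert u (vset h R1)) + card (insert v (vset h R2)) \<le> card (vset h Q)" .
  have "card Q = Suc (card R)" unfolding R_def using fQ e by (rule card.remove)
  moreover have "card R = card R1 + card R2"
  proof -
    have "R = R1 \<union> R2" "R1 \<inter> R2 = {}" by (auto simp: R1_def R2_def)
    then show ?thesis using R12 by (simp add: card_Un_disjoint)
  qed
  ultimately show ?case using c c1 c2 by linarith
qed

text \<open>A set of vertices is grown from \<open>r\<close>, with one new edge per new vertex.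
  While some \<open>y\<close> is missing, a walk from \<open>r\<close> to \<open>y\<close> leaves
  the set along an edge not yet collected.\<close>

lemma connected_card_edges:
  assumes G: "multigraph G" "connected_graph G"
  shows "card (verts G) \<le> card (edges G) + 1"
proof -
  have fin: "finite (verts G)" "finite (edges G)" using G(1) by (auto simp: multigraph_def)
  obtain r where r: "r \<in> verts G" using G(2) by (auto simp: connected_graph_def)
  have "Suc m \<le> card (verts G) \<Longrightarrow> \<exists>S Q. S \<subseteq> verts G \<and> r \<in> S \<and> card S = Suc m \<and> Q \<subseteq> edges G \<and>
      card Q = m \<and> (\<forall>e \<in> Q. ends G e \<subseteq> S)" for m
  proof (induction m)
    case 0
    show ?case using r by (intro exI[of _ "{r}"] exI[of _ "{}"]) simp
  next
    case (Suc m)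
    have "Suc m \<le> card (verts G)" using Suc.prems by (rule Suc_leD)
    from Suc.IH[OF this] obtain S Q where S: "S \<subseteq> verts G" "r \<in> S" "card S = Suc m"
      "Q \<subseteq> edges G" "card Q = m" "\<forall>e \<in> Q. ends G e \<subseteq> S" by (elim exE conjE)
    have "S \<noteq> verts G" using S(3) Suc.prems by auto
    then obtain y where y: "y \<in> verts G" "y \<notin> S" using S(1) by blast
    obtain vs es where w: "walk G vs es" "hd vs = r" "last vs = y"
      using G(2) r y(1) unfolding connected_graph_def by blast
    have len: "length vs = Suc (length es)" using w(1) by (simp add: walk_def)
    then have "vs \<noteq> []" by auto
    then have e: "vs ! 0 \<in> S" "vs ! length es \<notin> S"
      using w(2,3) S(2) y(2) len by (simp_all add: hd_conv_nth last_conv_nth)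
    have "\<exists>i < length es. vs ! i \<in> S \<and> vs ! Suc i \<notin> S"
    proof (rule ccontr)
      assume no: "\<not> ?thesis"
      have "i \<le> length es \<Longrightarrow> vs ! i \<in> S" for i
      proof (induction i)
        case 0 show ?case by (rule e(1))
      next
        case (Suc i)
        then have i: "i < length es" by simp
        then have "vs ! i \<in> S" using Suc.IH by simp
        then show ?case using no i by blast
      qed
      then show False using e(2) by blast
    qed
    then obtain i where i: "i < length es" "vs ! i \<in> S" "vs ! Suc i \<notin> S" by blast
    have ei: "es ! i \<in> edges G" "ends G (es ! i) = {vs ! i, vs ! Suc i}"
      using w(1) i(1) nth_mem[OF i(1)] by (auto simp: walk_def)
    have vi: "vs ! Suc i \<in> verts G" using G(1) ei by (auto simp: multigraph_def)
    have "finite S" "finite Q" using S(1,4) fin by (auto intro: finite_subset)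
    moreover have "es ! i \<notin> Q" using S(6) ei(2) i(3) by blast
    ultimately have "card (insert (vs ! Suc i) S) = Suc (Suc m)" "card (insert (es ! i) Q) = Suc m"
      using S(3,5) i(3) by simp_all
    moreover have "\<forall>e \<in> insert (es ! i) Q. ends G e \<subseteq> insert (vs ! Suc i) S"
    proof
      fix e assume "e \<in> insert (es ! i) Q"
      then show "ends G e \<subseteq> insert (vs ! Suc i) S"
      proof
        assume "e = es ! i"
        then show ?thesis using ei(2) i(2) by simp
      next
        assume "e \<in> Q"
        then have "ends G e \<subseteq> S" using S(6) by (rule bspec[rotated])
        then show ?thesis by (rule subset_insertI2)
      qed
    qed
    moreover have "insert (vs ! Suc i) S \<subseteq> verts G" "r \<in> insert (vs ! Suc i) S" "insert (es ! i) Q \<subseteq> edges G"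
      using S(1,2,4) vi ei(1) by simp_all
    ultimately show ?case
      by (intro exI[of _ "insert (vs ! Suc i) S"] exI[of _ "insert (es ! i) Q"] conjI)
  qed
  note grow = this
  have "card (verts G) \<noteq> 0" using r fin(1) by auto
  then have "Suc (card (verts G) - 1) \<le> card (verts G)" by simp
  from grow[OF this] obtain Q where "Q \<subseteq> edges G" "card Q = card (verts G) - 1" by (elim exE conjE)
  then have "card (verts G) - 1 \<le> card (edges G)" using card_mono[OF fin(2)] by metis
  then show ?thesis by linarith
qed

text \<open>Acyclicity bounds the number of edges from above, connectedness from below.\<close>

lemma tree_set_if_tree:
  assumes T: "tree T" "half_edges T h"
  shows "tree_set (verts T) h (edges T)"
proof -
  have t: "multigraph T" "connected_graph T" "\<nexists>vs es. cycle T vs es" using T(1) by (auto simp: tree_def)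
  have fin: "finite (verts T)" "finite (edges T)" using t(1) by (auto simp: multigraph_def)
  have sp: "sparse 1 h (edges T)"
    unfolding sparse_def using acyclic_sparse[OF t(1) T(2) t(3)] by simp
  have V: "vset h (edges T) \<subseteq> verts T"
    unfolding vset_eq_Union_ends[OF T(2) subset_refl] using t(1) by (auto simp: multigraph_def)
  have "card (edges T) + 1 \<le> card (verts T)"
  proof (cases "edges T = {}")
    case True
    have "verts T \<noteq> {}" using t(2) by (simp add: connected_graph_def)
    then have "card (verts T) \<noteq> 0" using fin(1) by simp
    then show ?thesis using True by simp
  next
    case False
    have "card (edges T) + 1 \<le> card (vset h (edges T))"
      by (rule acyclic_sparse[OF t(1) T(2) t(3) subset_refl False])
    also have "\<dots> \<le> card (verts T)" by (rule card_mono[OF fin(1) V])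
    finally show ?thesis .
  qed
  then show ?thesis using connected_card_edges[OF t(1,2)] sp fin(2) V by (simp add: tree_set_def)
qed

text \<open>A cycle has as many edges as vertices, contrary to sparsity. If the component of
  \<open>u\<close> were not everything, it and its complement would each have fewer edges than
  vertices, so one edge would be missing overall.\<close>

lemma tree_if_tree_set:
  assumes T: "multigraph T" "half_edges T h" "tree_set (verts T) h (edges T)"
  shows "tree T"
proof -
  let ?en = "ends T"
  have fin: "finite (verts T)" "finite (edges T)" and
    ends: "\<And>e. e \<in> edges T \<Longrightarrow> ?en e \<subseteq> verts T \<and> card (?en e) = 2"
    using T(1) by (auto simp: multigraph_def)
  have sp: "sparse 1 h (edges T)" and c: "card (edges T) + 1 = card (verts T)"
    using T(3) by (auto simp: tree_set_def)
  have "\<not> cycle T vs es" for vs es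
  proof
    assume cy: "cycle T vs es"
    then have l: "length vs = length es" "2 \<le> length es" "set es \<subseteq> edges T" "distinct es"
      "\<And>i. i < length es \<Longrightarrow> ?en (es ! i) = {vs ! i, vs ! (Suc i mod length vs)}"
      by (auto simp: cycle_def)
    have ne: "set es \<noteq> {}" using l(2) by auto
    have "vset h (set es) \<subseteq> set vs"
    proof
      fix x assume "x \<in> vset h (set es)"
      then obtain e where "e \<in> set es" "x \<in> ?en e" unfolding vset_eq_Union_ends[OF T(2) l(3)] by blast
      then obtain i where i: "i < length es" "x \<in> ?en (es ! i)" by (auto simp: in_set_conv_nth)
      have "Suc i mod length vs < length vs" using l(1,2) by (intro mod_less_divisor) linarith
      then show "x \<in> set vs" using i l(1) l(5)[OF i(1)] by auto
    qed
    then have "card (vset h (set es)) \<le> card (set vs)" by (intro card_mono) simp_all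
    also have "\<dots> \<le> length es" using card_length[of vs] l(1) by simp
    also have "\<dots> = card (set es)" using l(4) by (simp add: distinct_card)
    finally show False using sparseD[OF sp l(3) ne] by simp
  qed
  moreover have "connected_graph T"
    unfolding connected_graph_def
  proof (intro conjI ballI)
    have "card (verts T) \<noteq> 0" using c by linarith
    then show "verts T \<noteq> {}" by (metis card.empty)
    fix u v assume uv: "u \<in> verts T" "v \<in> verts T"
    define X where "X = {x. (u, x) \<in> (adj ?en (edges T))\<^sup>*}"
    have uX: "u \<in> X" by (simp add: X_def)
    have "verts T \<subseteq> X"
    proof (rule ccontr)
      assume no: "\<not> verts T \<subseteq> X"
      let ?V1 = "verts T \<inter> X" and ?V2 = "verts T - X"
      define E1 where "E1 = {e \<in> edges T. ?en e \<subseteq> X}"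
      define E2 where "E2 = edges T - E1"
      have E: "E1 \<subseteq> edges T" "E2 \<subseteq> edges T" "finite E1" "finite E2" using fin by (auto simp: E1_def E2_def)
      have dis: "?en f \<inter> X = {}" if "f \<in> E2" for f
        using that ends[of f] ends_subset_or_disjoint[of ?en f "edges T" X u] unfolding E1_def E2_def X_def by blast
      have le: "card F + 1 \<le> card W" if "F \<subseteq> edges T" "vset h F \<subseteq> W" "finite W" "W \<noteq> {}" for F W
      proof (cases "F = {}")
        case True
        have "card W \<noteq> 0" using that(3,4) by simp
        then show ?thesis using True by simp
      next
        case False
        have "card F + 1 \<le> 1 * card (vset h F)" by (rule sparseD[OF sp that(1) False])
        also have "\<dots> \<le> card W" using card_mono[OF that(3,2)] by simp
        finally show ?thesis .
      qed
      have "card E1 + 1 \<le> card ?V1"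
      proof (rule le[OF E(1)])
        show "vset h E1 \<subseteq> ?V1" unfolding vset_eq_Union_ends[OF T(2) E(1)] using ends by (auto simp: E1_def)
        show "?V1 \<noteq> {}" using uX uv(1) by blast
      qed (use fin in simp)
      moreover have "card E2 + 1 \<le> card ?V2"
      proof (rule le[OF E(2)])
        show "vset h E2 \<subseteq> ?V2"
          unfolding vset_eq_Union_ends[OF T(2) E(2)] using ends E(2) dis by blast
        show "?V2 \<noteq> {}" using no by blast
      qed (use fin in simp)
      moreover have "card (edges T) = card E1 + card E2"
      proof -
        have "edges T = E1 \<union> E2" "E1 \<inter> E2 = {}" by (auto simp: E1_def E2_def)
        then show ?thesis using card_Un_disjoint[OF E(3,4)] by simp
      qed
      moreover have "card (verts T) = card ?V1 + card ?V2"
      proof -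
        have "verts T = ?V1 \<union> ?V2" "?V1 \<inter> ?V2 = {}" by auto
        then show ?thesis using card_Un_disjoint[of ?V1 ?V2] fin(1) by simp
      qed
      ultimately show False using c by linarith
    qed
    then have "(u, v) \<in> (adj ?en (edges T))\<^sup>*" using uv(2) by (auto simp: X_def)
    then obtain vs es where w: "length vs = Suc (length es)" "hd vs = u" "last vs = v"
      "set es \<subseteq> edges T" "\<And>i. i < length es \<Longrightarrow> ?en (es ! i) = {vs ! i, vs ! Suc i}"
      using adj_path[of u v ?en "edges T"] by blast
    have "set vs \<subseteq> verts T"
    proof
      fix x assume "x \<in> set vs"
      then obtain i where i: "i < length vs" "x = vs ! i" by (auto simp: in_set_conv_nth)
      show "x \<in> verts T"
      proof (cases "i < length es")
        case True
        then have "es ! i \<in> edges T" using w(4) nth_mem[OF True] by blast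
        then show ?thesis using ends[of "es ! i"] w(5)[OF True] i by auto
      next
        case False
        then have "i = length vs - 1" using i w(1) by simp
        moreover have "vs \<noteq> []" using w(1) by auto
        ultimately have "x = v" using i w(3) by (simp add: last_conv_nth)
        then show ?thesis using uv by simp
      qed
    qed
    then have "walk T vs es" using w by (simp add: walk_def)
    then show "\<exists>vs es. walk T vs es \<and> hd vs = u \<and> last vs = v" using w(2,3) by blast
  qed
  ultimately show ?thesis using T(1) by (simp add: tree_def)
qed

text \<open>\<open>degree\<close> counts edges and \<open>deg\<close> counts half-edges; they agree
  because sparsity excludes loops.\<close>

lemma degree_eq_deg:
  assumes "half_edges T h" "sparse k h (edges T)"
  shows "degree T v = deg h (edges T) v"
proof -
  have "{e \<in> edges T. v \<in> ends T e} = fst ` {q \<in> edges T \<times> UNIV. h q = v}"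
  proof
    show "{e \<in> edges T. v \<in> ends T e} \<subseteq> fst ` {q \<in> edges T \<times> UNIV. h q = v}"
    proof
      fix e assume e: "e \<in> {e \<in> edges T. v \<in> ends T e}"
      then have "v = h (e, True) \<or> v = h (e, False)" using assms(1) by (auto simp: half_edges_def)
      then obtain i where "h (e, i) = v" by blast
      then show "e \<in> fst ` {q \<in> edges T \<times> UNIV. h q = v}"
        using e by (intro image_eqI[of _ _ "(e, i)"]) simp_all
    qed
    show "fst ` {q \<in> edges T \<times> UNIV. h q = v} \<subseteq> {e \<in> edges T. v \<in> ends T e}"
    proof (rule image_subsetI)
      fix q assume "q \<in> {q \<in> edges T \<times> UNIV. h q = v}"
      then have q: "fst q \<in> edges T" "h (fst q, snd q) = v" by (auto simp: mem_Times_iff)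
      then show "fst q \<in> {e \<in> edges T. v \<in> ends T e}"
        using assms(1) by (cases "snd q") (auto simp: half_edges_def)
    qed
  qed
  then show ?thesis unfolding degree_def deg_def
    using card_image[OF inj_on_fst_star[OF assms(2)], of v] by simp
qed

theorem theorem3:
  fixes k :: nat and G :: "('v, 'e) multigraph"
  assumes "k \<ge> 1" and "multiple_tree k G"
  shows "\<exists>T. spanning_tree_factorization k G T \<and>
    (\<forall>v \<in> verts G. \<forall>i \<in> {1..k}. \<forall>j \<in> {1..k}.
       \<bar>real (degree (T i) v) - real (degree (T j) v)\<bar> \<le> 22 * log 2 (real k))"
proof -
  obtain T0 where T0: "spanning_tree_factorization k G T0" and G: "multigraph G"
    using assms(2) by (auto simp: multiple_tree_def)
  show ?thesis
  proof (cases "k = 1")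
    case True
    \<comment> \<open>The bound is 0 here, but there is only one tree to compare with
      itself.\<close>
    then show ?thesis using T0 by (intro exI[of _ T0]) simp
  next
    case False
    then have k2: "2 \<le> k" using assms(1) by linarith
    obtain h where h: "half_edges G h" using half_edges_exist[OF G] by blast
    let ?I = "{1..k}" and ?V = "verts G"
    have fV: "finite ?V" using G by (simp add: multigraph_def)
    have st: "spanning_tree (T0 i) G" if "i \<in> ?I" for i
      using T0 that by (simp add: spanning_tree_factorization_def)
    have "tree_set ?V h (edges (T0 i))" if i: "i \<in> ?I" for i
    proof -
      have s: "subgraph (T0 i) G" "verts (T0 i) = ?V" "tree (T0 i)"
        using st[OF i] by (simp_all add: spanning_tree_def)
      have "half_edges (T0 i) h" using s(1) h by (auto simp: subgraph_def half_edges_def)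
      then show ?thesis using tree_set_if_tree[OF s(3)] s(2) by simp
    qed
    then have fam: "tree_family ?V h ?I (\<lambda>i. edges (T0 i))"
      using T0 by (simp add: tree_family_def spanning_tree_factorization_def)
    \<comment> \<open>\<open>m\<close> is the integer part of \<open>log 2 k\<close>, and it is
      positive because \<open>2 \<le> k\<close>.\<close>
    obtain m where m: "2 ^ m \<le> k" "k < 2 ^ (m + 1)" using ex_power_ivl1[of 2 k] assms(1) by auto
    have m1: "1 \<le> m"
    proof (rule ccontr)
      assume "\<not> 1 \<le> m"
      then have "m = 0" by simp
      then show False using m(2) k2 by simp
    qed
    have "\<exists>F. rebalance ?V h ?I ?I (\<lambda>i. edges (T0 i)) F \<and> spread_le h ?I F (12 * real m + 6)"
      by (rule balanced_tree_family[OF fam fV]) (use m m1 in simp_all)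
    then obtain F where F: "rebalance ?V h ?I ?I (\<lambda>i. edges (T0 i)) F" "spread_le h ?I F (12 * real m + 6)"
      by (elim exE conjE)
    have Un: "(\<Union>i \<in> ?I. F i) = edges G"
      using rebalanceD(2)[OF F(1)] T0 by (simp add: spanning_tree_factorization_def)
    have ts: "tree_set ?V h (F i)" if "i \<in> ?I" for i
      using rebalanceD(1)[OF F(1)] that by (simp add: tree_family_def)
    have dj: "F i \<inter> F j = {}" if "i \<in> ?I" "j \<in> ?I" "i \<noteq> j" for i j
      using rebalanceD(1)[OF F(1)] that by (simp add: tree_family_def)
    define T where "T i = \<lparr>verts = ?V, edges = F i, ends = ends G\<rparr>" for i
    have FG: "F i \<subseteq> edges G" if "i \<in> ?I" for i using Un that by blast
    have mg: "multigraph (T i)" if "i \<in> ?I" for i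
      using G FG[OF that] finite_subset[of "F i" "edges G"] by (auto simp: multigraph_def T_def)
    have he: "half_edges (T i) h" if "i \<in> ?I" for i
      using h FG[OF that] by (auto simp: half_edges_def T_def)
    have "spanning_tree (T i) G" if i: "i \<in> ?I" for i
    proof -
      have "tree (T i)" by (rule tree_if_tree_set[OF mg[OF i] he[OF i]]) (use ts[OF i] in \<open>simp add: T_def\<close>)
      then show ?thesis using mg[OF i] FG[OF i] by (simp add: spanning_tree_def subgraph_def T_def)
    qed
    then have fact: "spanning_tree_factorization k G T"
      using dj Un by (simp add: spanning_tree_factorization_def T_def)
    have deg: "degree (T i) v = deg h (F i) v" if i: "i \<in> ?I" for i v
      using degree_eq_deg[OF he[OF i], of 1 v] ts[OF i] by (simp add: T_def tree_set_def)
    have "real m \<le> log 2 (real k)" by (rule le_log2_of_power[OF m(1)])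
    moreover have "1 \<le> real m" using m1 by simp
    \<comment> \<open>As \<open>1 \<le> m\<close>, the left side is at most \<open>18 * m\<close>,
      within the constant 22.\<close>
    ultimately have "12 * real m + 6 \<le> 22 * log 2 (real k)" by linarith
    then have "\<bar>real (degree (T i) v) - real (degree (T j) v)\<bar> \<le> 22 * log 2 (real k)"
      if "i \<in> ?I" "j \<in> ?I" for i j v
      using spread_leD[OF F(2) that, of v] deg[OF that(1)] deg[OF that(2)] by (simp add: rdeg_def)
    then show ?thesis using fact by blast
  qed
qed

end
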